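(* Let $X$ be a compact convex set. Then the space $(A_f(X))^\mu$ is determined by extreme points, i.e. for every $u\in (A_f(X))^\mu$ and every $x\in X$, $$\inf u(\operatorname{ext}X)\le u(x)\le \sup u(\operatorname{ext} X).$$
   Context: A compact convex set is a compact convex subset of a (Hausdorff) locally convex real topological vector space; $\operatorname{ext}X$ is the set of its extreme points. A function $f:X\to\mathbb R$ is fragmented if for any $\epsilon>0$ and any nonempty closed set $F\subset X$ there is a nonempty relatively open $U\subset F$ with $\operatorname{diam} f(U)<\epsilon$. $A_f(X)$ is the space of all fragmented affine functions $f:X\to\mathbb R$ (such functions are automatically bounded). For a family $F$ of bounded real functions on $X$, $F^\mu$ denotes the smallest family of functions on $X$ that contains $F$ and is closed with respect to taking pointwise limits of monotone bounded sequences. *)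

theory Defs
  imports "HOL-Analysis.Analysis"
begin

text \<open>Hausdorff locally convex real topological vector spaces. The sort constraint on the type
  variable within a class command admits neither the product topology nor \<^const>\<open>convex\<close>, so
  joint continuity of scalar multiplication is phrased with filters (as the library does for
  topological addition) and convexity is unfolded; the usual forms follow as lemmas.\<close>

class locally_convex_space = real_vector + topological_ab_group_add + t2_space +
  assumes tendsto_scaleR_Pair:
    "LIM p (nhds c \<times>\<^sub>F nhds a). fst p *\<^sub>R snd p :> nhds (c *\<^sub>R a)"
  and locally_convex_zero:
    "open U \<Longrightarrow> 0 \<in> U \<Longrightarrow>
      \<exists>V. open V \<and> 0 \<in> V \<and> V \<subseteq> U \<and>
        (\<forall>x\<in>V. \<forall>y\<in>V. \<forall>s\<ge>0. \<forall>t\<ge>0. s + t = 1 \<longrightarrow> s *\<^sub>R x + t *\<^sub>R y \<in> V)"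

lemma continuous_on_scaleR_lcs:
  "continuous_on UNIV (\<lambda>p::real \<times> 'a::locally_convex_space. fst p *\<^sub>R snd p)"
  unfolding continuous_on_def
proof safe
  fix c :: real and a :: 'a
  show "((\<lambda>p. fst p *\<^sub>R snd p) \<longlongrightarrow> fst (c, a) *\<^sub>R snd (c, a)) (at (c, a))"
    unfolding fst_conv snd_conv
    by (rule filterlim_mono[OF tendsto_scaleR_Pair[where c = c and a = a] order_refl])
      (simp add: nhds_prod[symmetric] at_within_def)
qed

lemma locally_convex_zero_convex:
  fixes U :: "'a::locally_convex_space set"
  assumes "open U" "0 \<in> U"
  shows "\<exists>V. open V \<and> 0 \<in> V \<and> V \<subseteq> U \<and> convex V"
  using locally_convex_zero[OF assms] unfolding convex_def .

instance real_normed_vector \<subseteq> locally_convex_space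
proof
  fix c :: real and a :: 'a
  show "LIM p (nhds c \<times>\<^sub>F nhds a). fst p *\<^sub>R snd p :> nhds (c *\<^sub>R a)"
    by (intro tendsto_intros filterlim_fst filterlim_snd)
next
  fix U :: "'a set"
  assume "open U" "0 \<in> U"
  then obtain e where "e > 0" "ball 0 e \<subseteq> U"
    using open_contains_ball by blast
  moreover have "convex (ball (0::'a) e)"
    by simp
  ultimately show "\<exists>V. open V \<and> 0 \<in> V \<and> V \<subseteq> U \<and>
      (\<forall>x\<in>V. \<forall>y\<in>V. \<forall>s\<ge>0. \<forall>t\<ge>0. s + t = 1 \<longrightarrow> s *\<^sub>R x + t *\<^sub>R y \<in> V)"
    by (intro exI[of _ "ball 0 e"]) (auto simp: convex_def simp del: mem_ball)
qed

text \<open>A function on \<open>X\<close> is represented by a total function on the ambient type of which only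
  the values on \<open>X\<close> are relevant; all notions below are insensitive to the values off \<open>X\<close>.\<close>

text \<open>The boundedness conjunct is needed because \<^const>\<open>diameter\<close> is a real number
  and carries no information for unbounded sets.\<close>

definition fragmented_on :: "'a::topological_space set \<Rightarrow> ('a \<Rightarrow> real) \<Rightarrow> bool" where
  "fragmented_on X f \<longleftrightarrow>
    (\<forall>\<epsilon>>0. \<forall>F. closedin (top_of_set X) F \<and> F \<noteq> {} \<longrightarrow>
      (\<exists>U. openin (top_of_set F) U \<and> U \<noteq> {} \<and> bounded (f ` U) \<and> diameter (f ` U) < \<epsilon>))"

definition affine_fun_on :: "'a::real_vector set \<Rightarrow> ('a \<Rightarrow> real) \<Rightarrow> bool" where
  "affine_fun_on X f \<longleftrightarrow>
    (\<forall>x\<in>X. \<forall>y\<in>X. \<forall>t\<in>{0..1}. f ((1 - t) *\<^sub>R x + t *\<^sub>R y) = (1 - t) * f x + t * f y)"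

definition A_f :: "'a::locally_convex_space set \<Rightarrow> ('a \<Rightarrow> real) set" where
  "A_f X = {f. affine_fun_on X f \<and> fragmented_on X f}"

text \<open>A bounded sequence of functions is one that is bounded in the supremum norm over \<open>X\<close>.\<close>

inductive_set monotone_closure :: "'a set \<Rightarrow> ('a \<Rightarrow> real) set \<Rightarrow> ('a \<Rightarrow> real) set"
  for X :: "'a set" and F :: "('a \<Rightarrow> real) set" where
  base: "f \<in> F \<Longrightarrow> f \<in> monotone_closure X F"
| limit: "\<lbrakk>\<And>n. g n \<in> monotone_closure X F;
    (\<forall>x\<in>X. incseq (\<lambda>n. g n x)) \<or> (\<forall>x\<in>X. decseq (\<lambda>n. g n x));
    \<exists>C. \<forall>n. \<forall>x\<in>X. \<bar>g n x\<bar> \<le> C;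
    \<forall>x\<in>X. (\<lambda>n. g n x) \<longlonglongrightarrow> u x\<rbrakk> \<Longrightarrow> u \<in> monotone_closure X F"

text \<open>Infimum and supremum are taken in the extended reals, so that they have their usual meaning
  without any boundedness or nonemptiness side condition.\<close>

definition determined_by_extreme_points ::
    "'a::real_vector set \<Rightarrow> ('a \<Rightarrow> real) set \<Rightarrow> bool" where
  "determined_by_extreme_points X H \<longleftrightarrow>
    (\<forall>u\<in>H. \<forall>x\<in>X.
      (INF e\<in>{e. e extreme_point_of X}. ereal (u e)) \<le> ereal (u x) \<and>
      ereal (u x) \<le> (SUP e\<in>{e. e extreme_point_of X}. ereal (u e)))"

end

theory Submission
  imports Defs
begin

text \<open>By a variational principle of Stegall type, every \<open>u\<close> in the monotone closure has a small
  affine perturbation \<open>H\<close> which attains its maximum over \<open>X\<close> on a nonempty \<^emph>\<open>closed\<close> face.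
  An extreme point \<open>e\<close> of that face is extreme in \<open>X\<close>, and \<open>u e\<close> is almost \<open>sup u(X)\<close>;
  the lower bound follows by passing to \<open>- u\<close>.

  The perturbation is a uniform limit of perturbations chosen so that the sets of almost maximal
  points satisfy countably many smallness conditions. If \<open>u\<close> is generated by countably many
  fragmented affine functions \<open>f\<close> through a countable well-founded tree of monotone limits, these
  conditions say that each \<open>f\<close> has small oscillation on the closure of a set of almost maximal points,
  and that each limit is uniformly approximated on such a set by one of its approximants. Along any
  filter of almost maximal points converging to \<open>z\<close>, all these functions then converge to their
  values at \<open>z\<close>. Neither measures nor barycentres are needed.\<close>

section \<open>Hahn-Banach separation and extreme points\<close>

text \<open>The obstacle is that a function in the closure need not be semicontinuous, so it may
  miss its supremum and its maximisers need not form a closed set. Convergence along filters that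
  live on all the sets of almost maximal points replaces semicontinuity, both for the existence of
  maximisers and for closedness. Fragmentability controls a generator on a small relatively open
  piece of a closed set. Continuous affine perturbations can push almost maximal points only towards
  the closed convex hull of such a piece, so small oscillation has to be carried over to that hull.
  At a limit the perturbation is a multiple of u - g, with g an approximant: affine, but in general
  discontinuous. This is why perturbations are required to be affine and controlled instead of
  continuous; affineness is what turns the maximisers into a face. A step of size at most d / 8
  followed by a tolerance of at most d / 2 keeps the sum of all later steps below d / 4. Hence the
  sets of almost maximal points are nested and all of them contain the final maximisers.\<close>

lemma tendsto_scaleR_lcs [tendsto_intros]:
  fixes g :: "'b \<Rightarrow> 'a::locally_convex_space"
  assumes "(f \<longlongrightarrow> c) F" and "(g \<longlongrightarrow> a) F"
  shows "((\<lambda>x. f x *\<^sub>R g x) \<longlongrightarrow> c *\<^sub>R a) F"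
  using filterlim_compose[OF tendsto_scaleR_Pair filterlim_Pair[OF assms]] by simp

lemma continuous_on_scaleR_lcs' [continuous_intros]:
  fixes g :: "'b::topological_space \<Rightarrow> 'a::locally_convex_space"
  assumes "continuous_on S f" and "continuous_on S g"
  shows "continuous_on S (\<lambda>x. f x *\<^sub>R g x)"
  using assms unfolding continuous_on_def by (intro ballI tendsto_scaleR_lcs) auto

lemma open_affine_vimage:
  fixes S :: "'a::locally_convex_space set"
  assumes "open S"
  shows "open {x. b + c *\<^sub>R x \<in> S}"
  using open_vimage[OF assms, of "\<lambda>x. b + c *\<^sub>R x"]
  by (simp add: vimage_def continuous_intros)

lemma ex_affine_shift_mem_open:
  fixes S :: "'a::locally_convex_space set"
  assumes "open S" and "b \<in> S"
  obtains t :: real where "0 < t" and "t \<le> 1" and "b + t *\<^sub>R x \<in> S"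
proof -
  have "((\<lambda>t::real. b + t *\<^sub>R x) \<longlongrightarrow> b + 0 *\<^sub>R x) (at_right 0)"
    by (intro tendsto_intros)
  then have "eventually (\<lambda>t. b + t *\<^sub>R x \<in> S) (at_right (0::real))"
    using topological_tendstoD assms by fastforce
  moreover have "eventually (\<lambda>t. t \<in> {0<..<1}) (at_right (0::real))"
    by (rule eventually_at_right_real) simp
  ultimately have "eventually (\<lambda>t. b + t *\<^sub>R x \<in> S \<and> t \<in> {0<..<1}) (at_right (0::real))"
    by (rule eventually_conj)
  from eventually_happens'[OF trivial_limit_at_right_real this]
  show thesis
    using that by force
qed

text \<open>The half-space is obtained as a maximal open convex set \<open>P\<close> omitting the origin: maximality
  forces \<open>P\<close> to be a cone, and \<open>- (P \<union> - P)\<close> to be a hyperplane.\<close>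

lemma hahn_banach_open:
  fixes S :: "'a::locally_convex_space set"
  assumes "open S" and "convex S" and "0 \<notin> S" and "S \<noteq> {}"
  obtains \<phi> :: "'a \<Rightarrow> real" where "linear \<phi>" and "continuous_on UNIV \<phi>" and "\<And>x. x \<in> S \<Longrightarrow> 0 < \<phi> x"
proof -
  define \<A> where "\<A> = {P. open P \<and> convex P \<and> 0 \<notin> P \<and> S \<subseteq> P}"
  have "\<exists>M\<in>\<A>. \<forall>X\<in>\<A>. M \<subseteq> X \<longrightarrow> X = M"
  proof (rule subset_Zorn_nonempty)
    show "\<A> \<noteq> {}"
      using assms unfolding \<A>_def by blast
  next
    fix \<C> assume C: "\<C> \<noteq> {}" "subset.chain \<A> \<C>"
    have "convex (\<Union>\<C>)"
    proof (rule convexI)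
      fix x y and u v :: real
      assume uv: "x \<in> \<Union>\<C>" "y \<in> \<Union>\<C>" "0 \<le> u" "0 \<le> v" "u + v = 1"
      then obtain A B where "A \<in> \<C>" "B \<in> \<C>" "x \<in> A" "y \<in> B" by blast
      moreover from this have "A \<subseteq> B \<or> B \<subseteq> A"
        using C(2) unfolding subset.chain_def by blast
      ultimately obtain D where "D \<in> \<C>" "x \<in> D" "y \<in> D" by blast
      moreover from this have "convex D"
        using C(2) unfolding subset.chain_def \<A>_def by blast
      ultimately show "u *\<^sub>R x + v *\<^sub>R y \<in> \<Union>\<C>"
        using uv convexD by blast
    qed
    then show "\<Union>\<C> \<in> \<A>"
      using C unfolding \<A>_def subset.chain_def by blast
  qed
  then obtain P where "P \<in> \<A>" and "\<forall>X\<in>\<A>. P \<subseteq> X \<longrightarrow> X = P" by blast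
  then have P: "open P" "convex P" "0 \<notin> P" "S \<subseteq> P"
    and max: "\<And>Q. open Q \<Longrightarrow> convex Q \<Longrightarrow> 0 \<notin> Q \<Longrightarrow> P \<subseteq> Q \<Longrightarrow> Q = P"
    unfolding \<A>_def by (simp, simp, simp, simp, metis (no_types, lifting) mem_Collect_eq order_trans)
  have cone: "t *\<^sub>R x \<in> P" if "x \<in> P" "0 < t" for x and t :: real
  proof -
    \<comment> \<open>The union of all positive multiples of \<open>P\<close> competes with
      \<open>P\<close>, so maximality identifies the two.\<close>
    define Q where "Q = {y. \<exists>s>0. s *\<^sub>R y \<in> P}"
    have "Q = (\<Union>s\<in>{0<..}. {y. 0 + s *\<^sub>R y \<in> P})"
      unfolding Q_def by auto
    then have "open Q"
      by (simp only:) (intro open_UN ballI open_affine_vimage[OF P(1)])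
    moreover have "convex Q"
    proof (rule convexI)
      fix x y and u v :: real
      assume xy: "x \<in> Q" "y \<in> Q" "0 \<le> u" "0 \<le> v" "u + v = 1"
      then obtain s r where sr: "s > 0" "r > 0" "s *\<^sub>R x \<in> P" "r *\<^sub>R y \<in> P"
        unfolding Q_def by blast
      \<comment> \<open>Dividing by \<open>c\<close> turns u / s and v / r into convex weights for
        the points \<open>s *\<^sub>R x\<close> and \<open>r *\<^sub>R y\<close> of
        \<open>P\<close>.\<close>
      define c where "c = u / s + v / r"
      have c: "c > 0"
        unfolding c_def using sr xy
        by (metis add.commute add_cancel_left_right add_nonneg_pos add_pos_nonneg divide_nonneg_pos
            divide_pos_pos linorder_not_le order_antisym zero_less_one)
      have "u / s / c + v / r / c = 1"
        using c by (metis add_divide_distrib c_def divide_self less_irrefl)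
      then have "(u / s / c) *\<^sub>R (s *\<^sub>R x) + (v / r / c) *\<^sub>R (r *\<^sub>R y) \<in> P"
        using c sr xy by (intro convexD[OF P(2)]) auto
      then have "(1 / c) *\<^sub>R (u *\<^sub>R x + v *\<^sub>R y) \<in> P"
        using sr by (simp add: scaleR_add_right)
      then show "u *\<^sub>R x + v *\<^sub>R y \<in> Q"
        unfolding Q_def using c by (intro CollectI exI[of _ "1 / c"]) auto
    qed
    moreover have "0 \<notin> Q"
      unfolding Q_def using P(3) by auto
    moreover have "P \<subseteq> Q"
      unfolding Q_def by (auto intro: exI[of _ "1::real"])
    ultimately have "Q = P"
      by (rule max)
    moreover have "t *\<^sub>R x \<in> Q"
      unfolding Q_def using that by (intro CollectI exI[of _ "1 / t"]) auto
    ultimately show ?thesis by simp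
  qed
  have add: "x + y \<in> P" if "x \<in> P" "y \<in> P" for x y
  proof -
    have "(1/2) *\<^sub>R x + (1/2) *\<^sub>R y \<in> P"
      using that by (intro convexD[OF P(2)]) auto
    from cone[OF this, of 2] show ?thesis by (simp add: scaleR_add_right)
  qed
  have shift: "p + s *\<^sub>R x \<in> P" if x: "- x \<notin> P" and p: "p \<in> P" and s: "0 \<le> s" for x p and s :: real
  proof -
    \<comment> \<open>This is \<open>P\<close> plus the ray through \<open>x\<close>. If it
      contained 0, a positive multiple of \<open>- x\<close>, and hence \<open>- x\<close> itself,
      would lie in \<open>P\<close>.\<close>
    define Q where "Q = {y. \<exists>s\<ge>0. y + (- s) *\<^sub>R x \<in> P}"
    have "Q = (\<Union>s\<in>{0..}. {y. (- s) *\<^sub>R x + 1 *\<^sub>R y \<in> P})"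
      unfolding Q_def by (auto simp: add.commute)
    then have "open Q"
      by (simp only:) (intro open_UN ballI open_affine_vimage[OF P(1)])
    moreover have "convex Q"
    proof (rule convexI)
      fix y z and u v :: real
      assume yz: "y \<in> Q" "z \<in> Q" "0 \<le> u" "0 \<le> v" "u + v = 1"
      then obtain s r where sr: "s \<ge> 0" "r \<ge> 0" "y + (- s) *\<^sub>R x \<in> P" "z + (- r) *\<^sub>R x \<in> P"
        unfolding Q_def by blast
      have "u *\<^sub>R (y + (- s) *\<^sub>R x) + v *\<^sub>R (z + (- r) *\<^sub>R x) \<in> P"
        using yz sr by (intro convexD[OF P(2)]) auto
      then have "(u *\<^sub>R y + v *\<^sub>R z) + (- (u * s + v * r)) *\<^sub>R x \<in> P"
        by (simp add: algebra_simps)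
      then show "u *\<^sub>R y + v *\<^sub>R z \<in> Q"
        unfolding Q_def using yz sr by (intro CollectI exI[of _ "u * s + v * r"]) auto
    qed
    moreover have "0 \<notin> Q"
    proof
      assume "0 \<in> Q"
      then obtain s where s: "s \<ge> 0" "s *\<^sub>R (- x) \<in> P"
        unfolding Q_def by auto
      then have "s > 0"
        using P(3) by (cases "s = 0") auto
      with cone[OF s(2), of "1 / s"] x show False by simp
    qed
    moreover have "P \<subseteq> Q"
      unfolding Q_def by (auto intro: exI[of _ "0::real"])
    ultimately have "Q = P"
      by (rule max)
    moreover have "p + s *\<^sub>R x \<in> Q"
      unfolding Q_def using p s by (intro CollectI exI[of _ s]) auto
    ultimately show ?thesis by simp
  qed
  \<comment> \<open>The future kernel. The facts below make it a subspace, and \<open>ex\<close>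
    shows that it has codimension one.\<close>
  define H where "H = {x. x \<notin> P \<and> - x \<notin> P}"
  have PH: "p + x \<in> P" if "p \<in> P" "x \<in> H" for p x
    using shift[of x p 1] that unfolding H_def by simp
  have Hneg: "- x \<in> H" if "x \<in> H" for x
    using that unfolding H_def by simp
  have Hscale: "t *\<^sub>R x \<in> H" if "x \<in> H" for x and t :: real
  proof -
    have pos: "t *\<^sub>R x \<in> H" if "t > 0" "x \<in> H" for t :: real and x
      using cone[of "t *\<^sub>R x" "1 / t"] cone[of "- (t *\<^sub>R x)" "1 / t"] that unfolding H_def by auto
    consider "t > 0" | "t = 0" | "t < 0" by linarith
    then show ?thesis
    proof cases
      case 2
      then show ?thesis using P(3) by (simp add: H_def)
    next
      case 3
      then show ?thesis using pos[of "- t" "- x"] Hneg that by simp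
    qed (use pos that in auto)
  qed
  have Hadd: "x + y \<in> H" if "x \<in> H" "y \<in> H" for x y
  proof -
    have "x + y \<notin> P" if "x \<in> H" "y \<in> H" for x y
      using PH[of "x + y" "- x"] Hneg that unfolding H_def by auto
    from this[of x y] this[of "- x" "- y"] show ?thesis
      using Hneg that unfolding H_def by (simp add: add.commute)
  qed
  obtain p where p: "p \<in> P"
    using assms(4) P(4) by blast
  have ex: "\<exists>t. x - t *\<^sub>R p \<in> H" for x
  proof -
    \<comment> \<open>\<open>T\<close> is a down-set bounded above. At its supremum c, openness of
      \<open>P\<close> excludes both signs: \<open>x - c *\<^sub>R p\<close> in \<open>P\<close>
      would put a number above c into \<open>T\<close>, and its negative in \<open>P\<close> would
      keep a left neighbourhood of c out of \<open>T\<close>.\<close>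
    define T where "T = {t. x - t *\<^sub>R p \<in> P}"
    obtain a where a: "0 < a" "p + a *\<^sub>R x \<in> P"
      using ex_affine_shift_mem_open[OF P(1) p] by blast
    have "(1 / a) *\<^sub>R (p + a *\<^sub>R x) \<in> P"
      using cone a by simp
    then have "- (1 / a) \<in> T"
      using a by (simp add: T_def scaleR_add_right add.commute)
    then have ne: "T \<noteq> {}" by blast
    obtain b where b: "0 < b" "p + b *\<^sub>R (- x) \<in> P"
      using ex_affine_shift_mem_open[OF P(1) p] by blast
    have "(1 / b) *\<^sub>R (p + b *\<^sub>R (- x)) \<in> P"
      using cone b by simp
    then have b': "(1 / b) *\<^sub>R p - x \<in> P"
      using b by (simp add: scaleR_add_right scaleR_diff_right)
    have down: "s \<in> T" if "t \<in> T" "s \<le> t" for s t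
    proof (cases "s = t")
      case False
      then have "(x - t *\<^sub>R p) + (t - s) *\<^sub>R p \<in> P"
        using that cone p by (intro add) (auto simp: T_def)
      then show ?thesis by (simp add: T_def algebra_simps)
    qed (use that in auto)
    have bdd: "bdd_above T"
    proof (rule bdd_aboveI)
      fix t assume "t \<in> T"
      show "t \<le> 1 / b"
      proof (rule ccontr)
        assume "\<not> t \<le> 1 / b"
        then have "1 / b \<in> T" using down \<open>t \<in> T\<close> by simp
        then have "x - (1 / b) *\<^sub>R p \<in> P" by (simp add: T_def)
        from add[OF b' this] show False using P(3) by simp
      qed
    qed
    define c where "c = Sup T"
    have "x - c *\<^sub>R p \<notin> P"
    proof
      assume "x - c *\<^sub>R p \<in> P"
      from ex_affine_shift_mem_open[OF P(1) this, of "- p"] obtain t :: real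
        where "0 < t" "x - c *\<^sub>R p + t *\<^sub>R (- p) \<in> P" by blast
      then have "c + t \<in> T" by (simp add: T_def algebra_simps)
      from cSup_upper[OF this bdd] \<open>0 < t\<close> show False by (simp add: c_def)
    qed
    moreover have "- (x - c *\<^sub>R p) \<notin> P"
    proof
      assume "- (x - c *\<^sub>R p) \<in> P"
      from ex_affine_shift_mem_open[OF P(1) this, of "- p"] obtain t :: real
        where t: "0 < t" "- (x - c *\<^sub>R p) + t *\<^sub>R (- p) \<in> P" by blast
      then obtain r where "r \<in> T" "c - t < r"
        using less_cSupD[OF ne, of "c - t"] by (auto simp: c_def)
      then have "x - (c - t) *\<^sub>R p \<in> P" using down[of r "c - t"] by (simp add: T_def)
      from add[OF t(2) this] show False using P(3) by (simp add: algebra_simps)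
    qed
    ultimately show ?thesis unfolding H_def by blast
  qed
  have Hp: "t = 0" if "t *\<^sub>R p \<in> H" for t :: real
    using Hscale[OF that, of "1 / t"] p by (cases "t = 0") (auto simp: H_def)
  define \<phi> where "\<phi> x = (SOME t. x - t *\<^sub>R p \<in> H)" for x
  have \<phi>: "x - \<phi> x *\<^sub>R p \<in> H" for x
    unfolding \<phi>_def using someI_ex[OF ex] .
  have \<phi>_eq: "\<phi> x = t" if "x - t *\<^sub>R p \<in> H" for x t
  proof -
    have "(x - t *\<^sub>R p) + - (x - \<phi> x *\<^sub>R p) \<in> H"
      by (rule Hadd[OF that Hneg[OF \<phi>]])
    then have "(\<phi> x - t) *\<^sub>R p \<in> H" by (simp add: algebra_simps)
    then show ?thesis using Hp by fastforce
  qed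
  have lin: "linear \<phi>"
  proof (rule linearI)
    fix x y show "\<phi> (x + y) = \<phi> x + \<phi> y"
      using Hadd[OF \<phi>[of x] \<phi>[of y]] by (intro \<phi>_eq) (simp add: algebra_simps)
  next
    fix c :: real and x show "\<phi> (c *\<^sub>R x) = c *\<^sub>R \<phi> x"
      using Hscale[OF \<phi>[of x], of c] by (intro \<phi>_eq) (simp add: algebra_simps)
  qed
  have pos: "0 < \<phi> x \<longleftrightarrow> x \<in> P" for x
  proof
    assume "0 < \<phi> x"
    then have "\<phi> x *\<^sub>R p + (x - \<phi> x *\<^sub>R p) \<in> P"
      using PH \<phi> cone p by blast
    then show "x \<in> P" by simp
  next
    assume x: "x \<in> P"
    show "0 < \<phi> x"
    proof (rule ccontr)
      assume *: "\<not> 0 < \<phi> x"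
      have "x - \<phi> x *\<^sub>R p \<in> P"
      proof (cases "\<phi> x = 0")
        case False
        with * have "x + (- \<phi> x) *\<^sub>R p \<in> P"
          by (intro add[OF x cone[OF p]]) simp
        then show ?thesis by simp
      qed (use x in simp)
      then show False using \<phi> by (simp add: H_def)
    qed
  qed
  have \<phi>p: "\<phi> p = 1"
    using P(3) by (intro \<phi>_eq) (simp add: H_def)
  have gt: "open {x. a < \<phi> x}" for a
  proof -
    \<comment> \<open>As \<open>\<phi> p = 1\<close>, open half-lines pull back to translates of
      \<open>P\<close> or of its reflection, which gives continuity.\<close>
    have "{x. a < \<phi> x} = {x. (- a) *\<^sub>R p + 1 *\<^sub>R x \<in> P}"
      unfolding pos[symmetric] by (simp add: linear_add[OF lin] linear_scale[OF lin] linear_diff[OF lin] linear_neg[OF lin] \<phi>p)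
    then show ?thesis by (simp only: open_affine_vimage[OF P(1)])
  qed
  have lt: "open {x. \<phi> x < a}" for a
  proof -
    have "{x. \<phi> x < a} = {x. a *\<^sub>R p + (- 1) *\<^sub>R x \<in> P}"
      unfolding pos[symmetric] by (simp add: linear_add[OF lin] linear_scale[OF lin] linear_diff[OF lin] linear_neg[OF lin] \<phi>p)
    then show ?thesis by (simp only: open_affine_vimage[OF P(1)])
  qed
  have "continuous_on UNIV \<phi>"
    unfolding continuous_on_def
  proof (intro ballI order_tendstoI)
    fix x a
    show "eventually (\<lambda>y. a < \<phi> y) (at x)" if "a < \<phi> x"
      unfolding eventually_at_topological using gt[of a] that by blast
    show "eventually (\<lambda>y. \<phi> y < a) (at x)" if "\<phi> x < a"
      unfolding eventually_at_topological using lt[of a] that by blast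
  qed
  with lin that show thesis
    using P(4) pos by blast
qed

text \<open>Fattening \<open>C\<close> by an open convex neighbourhood V of 0 such that -V misses
  \<open>C\<close> gives an open convex set that still omits 0, and the open case applies.\<close>

lemma hahn_banach_compact:
  fixes C :: "'a::locally_convex_space set"
  assumes "compact C" and "convex C" and "0 \<notin> C"
  obtains \<phi> :: "'a \<Rightarrow> real" where "linear \<phi>" and "continuous_on UNIV \<phi>" and "\<And>x. x \<in> C \<Longrightarrow> 0 < \<phi> x"
proof (cases "C = {}")
  case True
  then show ?thesis
    using that[of "\<lambda>x. 0"] by (auto simp: linear_0 intro: linear_zero)
next
  case False
  have "open {x. 0 + (- 1) *\<^sub>R x \<in> - C}"
    using open_affine_vimage compact_imp_closed[OF assms(1)] by blast
  from locally_convex_zero_convex[OF this] obtain V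
    where V: "open V" "0 \<in> V" "convex V" "V \<subseteq> {x. - x \<notin> C}"
    using assms(3) by auto
  have "{c + v | c v. c \<in> C \<and> v \<in> V} = (\<Union>c\<in>C. {x. - c + 1 *\<^sub>R x \<in> V})" (is "?S = _")
    by (auto, metis add_minus_cancel diff_conv_add_uminus add.commute)
  moreover have "open (\<Union>c\<in>C. {x. - c + 1 *\<^sub>R x \<in> V})"
    using open_affine_vimage[OF V(1)] by (intro open_UN ballI)
  ultimately have "open ?S" by simp
  moreover have "convex ?S"
    using convex_sums[OF assms(2) V(3)] by (rule back_subst[of convex]) auto
  moreover have "0 \<notin> ?S"
    using V(4) by (auto simp: eq_neg_iff_add_eq_0 subset_eq) (metis add.commute eq_neg_iff_add_eq_0)
  moreover have "C \<subseteq> ?S"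
    using V(2) by force
  ultimately obtain \<phi> :: "'a \<Rightarrow> real"
    where "linear \<phi>" "continuous_on UNIV \<phi>" "\<And>x. x \<in> ?S \<Longrightarrow> 0 < \<phi> x"
    using hahn_banach_open[of ?S] False by blast
  with \<open>C \<subseteq> ?S\<close> that show ?thesis by blast
qed

section \<open>Minimal sets and the existence of extreme points\<close>

lemma ex_minimal_set:
  assumes "A \<in> \<S>"
    and "\<And>\<C>. \<C> \<noteq> {} \<Longrightarrow> \<C> \<subseteq> \<S> \<Longrightarrow> (\<And>S T. S \<in> \<C> \<Longrightarrow> T \<in> \<C> \<Longrightarrow> S \<subseteq> T \<or> T \<subseteq> S) \<Longrightarrow> \<Inter>\<C> \<in> \<S>"
  shows "\<exists>M\<in>\<S>. \<forall>N\<in>\<S>. N \<subseteq> M \<longrightarrow> N = M"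
proof -
  \<comment> \<open>Complementation turns minimal sets into maximal ones and intersections of chains
    into unions.\<close>
  have "\<exists>M\<in>uminus ` \<S>. \<forall>N\<in>uminus ` \<S>. M \<subseteq> N \<longrightarrow> N = M"
  proof (rule subset_Zorn_nonempty)
    show "uminus ` \<S> \<noteq> {}"
      using assms(1) by blast
  next
    fix \<C> assume C: "\<C> \<noteq> {}" "subset.chain (uminus ` \<S>) \<C>"
    have "\<Inter>(uminus ` \<C>) \<in> \<S>"
    proof (rule assms(2))
      show "uminus ` \<C> \<noteq> {}" "uminus ` \<C> \<subseteq> \<S>"
        using C unfolding subset.chain_def by auto
      show "S \<subseteq> T \<or> T \<subseteq> S" if "S \<in> uminus ` \<C>" "T \<in> uminus ` \<C>" for S T
        using C(2) that unfolding subset.chain_def by blast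
    qed
    then have "- \<Inter>(uminus ` \<C>) \<in> uminus ` \<S>" by blast
    then show "\<Union>\<C> \<in> uminus ` \<S>" by simp
  qed
  then show ?thesis by auto
qed

text \<open>A nonempty finite subfamily of a chain contains its own intersection, so the finite
  intersection property reduces to single members.\<close>

lemma compact_Int_chain_nonempty:
  assumes "compact K" and "\<C> \<noteq> {}"
    and closed: "\<And>S. S \<in> \<C> \<Longrightarrow> closed S"
    and ne: "\<And>S. S \<in> \<C> \<Longrightarrow> K \<inter> S \<noteq> {}"
    and chain: "\<And>S T. S \<in> \<C> \<Longrightarrow> T \<in> \<C> \<Longrightarrow> S \<subseteq> T \<or> T \<subseteq> S"
  shows "K \<inter> \<Inter>\<C> \<noteq> {}"
proof (rule compact_imp_fip[OF assms(1) closed])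
  fix F assume F: "finite F" "F \<subseteq> \<C>"
  have "F \<noteq> {} \<Longrightarrow> \<Inter>F \<in> F"
    using F
  proof (induction F rule: finite_induct)
    case (insert S F)
    then show ?case
    proof (cases "F = {}")
      case False
      then have "\<Inter>F \<in> F" using insert by blast
      then have "S \<subseteq> \<Inter>F \<or> \<Inter>F \<subseteq> S" using chain insert by blast
      then show ?thesis using \<open>\<Inter>F \<in> F\<close> by (auto simp: Int_absorb1 Int_absorb2)
    qed auto
  qed auto
  then show "K \<inter> \<Inter>F \<noteq> {}"
    using F assms(2) ne by (cases "F = {}") (fastforce, blast)
qed

text \<open>A minimal nonempty compact face is a singleton: otherwise a continuous functional
  separates two of its points, and the minimisers of that functional form a strictly smaller compact
  face.\<close>

lemma ex_extreme_point_of: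
  fixes A :: "'a::locally_convex_space set"
  assumes "compact A" and "convex A" and "A \<noteq> {}"
  obtains e where "e extreme_point_of A"
proof -
  define \<S> where "\<S> = {F. F face_of A \<and> compact F \<and> F \<noteq> {}}"
  have "\<exists>F\<in>\<S>. \<forall>N\<in>\<S>. N \<subseteq> F \<longrightarrow> N = F"
  proof (rule ex_minimal_set)
    show "A \<in> \<S>"
      using assms by (simp add: \<S>_def face_of_refl)
  next
    fix \<C> assume C: "\<C> \<noteq> {}" "\<C> \<subseteq> \<S>" "\<And>S T. S \<in> \<C> \<Longrightarrow> T \<in> \<C> \<Longrightarrow> S \<subseteq> T \<or> T \<subseteq> S"
    have sub: "F \<subseteq> A \<and> closed F" if "F \<in> \<C>" for F
      using that C(2) face_of_imp_subset compact_imp_closed unfolding \<S>_def by blast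
    have "A \<inter> \<Inter>\<C> \<noteq> {}"
      using C sub by (intro compact_Int_chain_nonempty[OF assms(1)]) (auto simp: \<S>_def, blast)
    moreover have "\<Inter>\<C> face_of A"
      using C by (intro face_of_Inter) (auto simp: \<S>_def)
    moreover have "compact (A \<inter> \<Inter>\<C>)"
      using assms(1) sub by (intro compact_Int_closed closed_Inter) auto
    moreover have "A \<inter> \<Inter>\<C> = \<Inter>\<C>"
      using sub C(1) by blast
    ultimately show "\<Inter>\<C> \<in> \<S>" by (simp add: \<S>_def)
  qed
  then obtain F where F: "F \<in> \<S>" and min: "\<And>N. N \<in> \<S> \<Longrightarrow> N \<subseteq> F \<Longrightarrow> N = F"
    by blast
  from F obtain e where e: "e \<in> F" by (auto simp: \<S>_def)
  have "F = {e}"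
  proof (rule ccontr)
    assume "F \<noteq> {e}"
    then obtain e' where e': "e' \<in> F" "e' \<noteq> e" using e by blast
    obtain \<phi> :: "'a \<Rightarrow> real" where \<phi>: "linear \<phi>" "continuous_on UNIV \<phi>" "\<And>x. x \<in> {e - e'} \<Longrightarrow> 0 < \<phi> x"
      using hahn_banach_compact[of "{e - e'}"] e' by auto
    have "compact F" "F face_of A" using F by (auto simp: \<S>_def)
    then obtain m where m: "m \<in> F" "\<And>x. x \<in> F \<Longrightarrow> \<phi> m \<le> \<phi> x"
      using continuous_attains_inf[of F \<phi>] e \<phi>(2) continuous_on_subset by blast
    define G where "G = {x \<in> F. \<phi> x = \<phi> m}"
    have "G face_of F"
      unfolding face_of_def
    proof (intro conjI ballI impI)
      show "convex G"
        using face_of_imp_convex[OF \<open>F face_of A\<close>]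
        by (auto simp: G_def convex_def linear_add[OF \<phi>(1)] linear_scale[OF \<phi>(1)] simp flip: distrib_right)
    next
      fix a b x assume ab: "a \<in> F" "b \<in> F" "x \<in> G" "x \<in> open_segment a b"
      then obtain t where t: "0 < t" "t < 1" "x = (1 - t) *\<^sub>R a + t *\<^sub>R b"
        by (auto simp: in_segment)
      have "\<phi> x = (1 - t) * \<phi> a + t * \<phi> b"
        unfolding t(3) by (simp only: linear_add[OF \<phi>(1)] linear_scale[OF \<phi>(1)] real_scaleR_def)
      then have "(1 - t) * (\<phi> a - \<phi> m) + t * (\<phi> b - \<phi> m) = 0"
        using ab(3) by (simp add: G_def algebra_simps)
      moreover have "0 \<le> (1 - t) * (\<phi> a - \<phi> m)" "0 \<le> t * (\<phi> b - \<phi> m)"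
        using m(2) ab t by auto
      ultimately have "(1 - t) * (\<phi> a - \<phi> m) = 0" "t * (\<phi> b - \<phi> m) = 0" by linarith+
      then show "a \<in> G" "b \<in> G" using ab t by (auto simp: G_def)
    qed (auto simp: G_def)
    moreover have "compact G"
    proof -
      have "closed {x. \<phi> x = \<phi> m}"
        using \<phi>(2) by (intro closed_Collect_eq) (auto intro: continuous_intros)
      then have "compact (F \<inter> {x. \<phi> x = \<phi> m})"
        using \<open>compact F\<close> by blast
      moreover have "F \<inter> {x. \<phi> x = \<phi> m} = G" by (auto simp: G_def)
      ultimately show ?thesis by simp
    qed
    ultimately have "G \<in> \<S>"
      using m(1) face_of_trans \<open>F face_of A\<close> by (auto simp: \<S>_def G_def)
    from min[OF this] have "G = F" by (auto simp: G_def)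
    then have "e \<in> G" "e' \<in> G" using e e'(1) by auto
    then have "\<phi> e = \<phi> e'" by (simp add: G_def)
    then show False using \<phi> by (simp add: linear_diff)
  qed
  with F that show thesis by (auto simp: \<S>_def face_of_singleton)
qed

section \<open>Fragmented affine functions\<close>

lemma affine_fun_onD:
  assumes "affine_fun_on X f" "x \<in> X" "y \<in> X" "0 \<le> u" "0 \<le> v" "u + v = 1"
  shows "f (u *\<^sub>R x + v *\<^sub>R y) = u * f x + v * f y"
proof -
  have "u = 1 - v" "v \<in> {0..1}" using assms by auto
  with assms(1-3) show ?thesis unfolding affine_fun_on_def by blast
qed

lemma affine_fun_on_add:
  assumes "affine_fun_on X f" and "affine_fun_on X g"
  shows "affine_fun_on X (\<lambda>x. f x + g x)"
  unfolding affine_fun_on_def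
proof (intro ballI)
  fix x y and t :: real assume "x \<in> X" "y \<in> X" "t \<in> {0..1}"
  then have "f ((1 - t) *\<^sub>R x + t *\<^sub>R y) = (1 - t) * f x + t * f y"
    and "g ((1 - t) *\<^sub>R x + t *\<^sub>R y) = (1 - t) * g x + t * g y"
    using assms unfolding affine_fun_on_def by blast+
  then show "f ((1 - t) *\<^sub>R x + t *\<^sub>R y) + g ((1 - t) *\<^sub>R x + t *\<^sub>R y) =
      (1 - t) * (f x + g x) + t * (f y + g y)"
    by (simp add: algebra_simps)
qed

lemma affine_fun_on_cmult:
  assumes "affine_fun_on X f"
  shows "affine_fun_on X (\<lambda>x. c * f x)"
  unfolding affine_fun_on_def
proof (intro ballI)
  fix x y and t :: real assume "x \<in> X" "y \<in> X" "t \<in> {0..1}"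
  then have "f ((1 - t) *\<^sub>R x + t *\<^sub>R y) = (1 - t) * f x + t * f y"
    using assms unfolding affine_fun_on_def by blast
  then show "c * f ((1 - t) *\<^sub>R x + t *\<^sub>R y) = (1 - t) * (c * f x) + t * (c * f y)"
    by (simp add: distrib_left mult.left_commute)
qed

lemma affine_fun_on_uminus: "affine_fun_on X f \<Longrightarrow> affine_fun_on X (\<lambda>x. - f x)"
  using affine_fun_on_cmult[of X f "-1"] by simp

lemma affine_fun_on_diff:
  "affine_fun_on X f \<Longrightarrow> affine_fun_on X g \<Longrightarrow> affine_fun_on X (\<lambda>x. f x - g x)"
  using affine_fun_on_add[OF _ affine_fun_on_uminus] by simp

lemma affine_fun_on_lim:
  assumes "convex X" and g: "\<And>n. affine_fun_on X (g n)"
    and lim: "\<And>x. x \<in> X \<Longrightarrow> (\<lambda>n. g n x) \<longlonglongrightarrow> u x"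
  shows "affine_fun_on X u"
  unfolding affine_fun_on_def
proof (intro ballI)
  fix x y and t :: real assume *: "x \<in> X" "y \<in> X" "t \<in> {0..1}"
  have "(\<lambda>n. (1 - t) * g n x + t * g n y) \<longlonglongrightarrow> (1 - t) * u x + t * u y"
    by (intro tendsto_intros lim *)
  moreover have "(1 - t) * g n x + t * g n y = g n ((1 - t) *\<^sub>R x + t *\<^sub>R y)" for n
    using g * unfolding affine_fun_on_def by metis
  moreover have "(1 - t) *\<^sub>R x + t *\<^sub>R y \<in> X"
    using * by (intro convexD[OF assms(1)]) auto
  ultimately show "u ((1 - t) *\<^sub>R x + t *\<^sub>R y) = (1 - t) * u x + t * u y"
    using lim[of "(1 - t) *\<^sub>R x + t *\<^sub>R y"] LIMSEQ_unique by simp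
qed

lemma convex_affine_ge:
  assumes "affine_fun_on X f" and "convex X"
  shows "convex {x \<in> X. c \<le> f x}"
proof (rule convexI)
  fix x y and u v :: real
  assume *: "x \<in> {x \<in> X. c \<le> f x}" "y \<in> {x \<in> X. c \<le> f x}" "0 \<le> u" "0 \<le> v" "u + v = 1"
  have "u * c + v * c \<le> u * f x + v * f y"
    using * by (intro add_mono mult_left_mono) auto
  also have "u * c + v * c = c" using * by (simp flip: distrib_right)
  finally show "u *\<^sub>R x + v *\<^sub>R y \<in> {x \<in> X. c \<le> f x}"
    using * convexD[OF assms(2)] affine_fun_onD[OF assms(1)] by auto
qed

lemma convex_affine_le:
  assumes "affine_fun_on X f" and "convex X"
  shows "convex {x \<in> X. f x \<le> c}"
  using convex_affine_ge[OF affine_fun_on_uminus[OF assms(1)] assms(2), of "- c"] by simp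

lemma affine_convex_hull_le:
  assumes "affine_fun_on X f" and "convex X" and "E \<subseteq> X" and "\<And>e. e \<in> E \<Longrightarrow> f e \<le> c"
    and "x \<in> convex hull E"
  shows "f x \<le> c"
  using hull_minimal[of E "{x \<in> X. f x \<le> c}" convex] convex_affine_le[OF assms(1,2)] assms(3-5)
  by blast

text \<open>Fragmentability in the form used below: an ambient open set instead of a relatively open
  one, and pairwise differences instead of a diameter.\<close>

lemma fragmented_onD:
  assumes "fragmented_on X f" and "closed F" and "F \<subseteq> X" and "F \<noteq> {}" and "0 < \<epsilon>"
  obtains O' where "open O'" and "F \<inter> O' \<noteq> {}" and "bounded (f ` (F \<inter> O'))"
    and "\<And>x y. x \<in> F \<inter> O' \<Longrightarrow> y \<in> F \<inter> O' \<Longrightarrow> \<bar>f x - f y\<bar> < \<epsilon>"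
proof -
  obtain U where U: "openin (top_of_set F) U" "U \<noteq> {}" "bounded (f ` U)" "diameter (f ` U) < \<epsilon>"
    using assms(1)[unfolded fragmented_on_def, rule_format, OF assms(5), of F]
      closed_subset[OF assms(3,2)] assms(4) by metis
  then obtain O' where O': "open O'" "U = F \<inter> O'" by (auto simp: openin_open)
  show thesis
  proof (rule that[OF O'(1)])
    fix x y assume "x \<in> F \<inter> O'" "y \<in> F \<inter> O'"
    then have "dist (f x) (f y) \<le> diameter (f ` U)"
      using U(3) O' by (intro diameter_bounded_bound) auto
    then show "\<bar>f x - f y\<bar> < \<epsilon>" using U(4) by (simp add: dist_real_def)
  qed (use U O' in auto)
qed

lemma fragmented_on_uminus:
  fixes f :: "'a::topological_space \<Rightarrow> real"
  assumes "fragmented_on X f"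
  shows "fragmented_on X (\<lambda>x. - f x)"
  unfolding fragmented_on_def
proof (intro allI impI)
  fix \<epsilon> :: real and F assume \<epsilon>: "\<epsilon> > 0" and F: "closedin (top_of_set X) F \<and> F \<noteq> {}"
  then obtain U where U: "openin (top_of_set F) U" "U \<noteq> {}" "bounded (f ` U)" "diameter (f ` U) < \<epsilon>"
    using assms[unfolded fragmented_on_def, rule_format, OF \<epsilon> F] by metis
  have "diameter ((\<lambda>x. - f x) ` U) \<le> diameter (f ` U)"
  proof (rule diameter_le)
    fix x y assume "x \<in> (\<lambda>x. - f x) ` U" "y \<in> (\<lambda>x. - f x) ` U"
    then obtain a b where "a \<in> U" "b \<in> U" "x = - f a" "y = - f b" by blast
    then show "norm (x - y) \<le> diameter (f ` U)"
      using diameter_bounded_bound[OF U(3), of "f a" "f b"] by (simp add: dist_real_def)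
  qed (use U(2) in simp)
  moreover have "bounded ((\<lambda>x. - f x) ` U)"
    using U(3) by (auto simp: bounded_iff)
  ultimately show "\<exists>U. openin (top_of_set F) U \<and> U \<noteq> {} \<and> bounded ((\<lambda>x. - f x) ` U) \<and>
      diameter ((\<lambda>x. - f x) ` U) < \<epsilon>"
    using U by (intro exI[of _ U]) auto
qed

section \<open>Closures and neighbourhoods of convex sets\<close>

lemma closure_meets_open:
  assumes "x \<in> closure S" and "open V" and "x \<in> V"
  obtains y where "y \<in> S" and "y \<in> V"
  using assms open_Int_closure_eq_empty[of V S] by blast

lemma convex_closure_lcs:
  fixes S :: "'a::locally_convex_space set"
  assumes "convex S"
  shows "convex (closure S)"
proof (rule convexI)
  fix x y and u v :: real
  assume *: "x \<in> closure S" "y \<in> closure S" "0 \<le> u" "0 \<le> v" "u + v = 1"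
  have "(\<lambda>p. u *\<^sub>R fst p + v *\<^sub>R snd p) ` closure (S \<times> S) \<subseteq> closure S"
  proof (rule image_closure_subset)
    show "(\<lambda>p. u *\<^sub>R fst p + v *\<^sub>R snd p) ` (S \<times> S) \<subseteq> closure S"
      using convexD[OF assms] * closure_subset by fastforce
    show "continuous_on (closure (S \<times> S)) (\<lambda>p. u *\<^sub>R fst p + v *\<^sub>R snd p)"
      by (intro continuous_intros)
  qed (rule closed_closure)
  then show "u *\<^sub>R x + v *\<^sub>R y \<in> closure S"
    using * by (auto simp: closure_Times image_subset_iff)
qed

lemma ex_convex_nhd:
  fixes O' :: "'a::locally_convex_space set"
  assumes "open O'" and "e \<in> O'"
  obtains U where "open U" and "convex U" and "e \<in> U" and "closure U \<subseteq> O'"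
proof -
  have "open {x. e + 1 *\<^sub>R x \<in> O'}" by (rule open_affine_vimage[OF assms(1)])
  then obtain V where V: "open V" "0 \<in> V" "V \<subseteq> {x. e + 1 *\<^sub>R x \<in> O'}" "convex V"
    using locally_convex_zero_convex[of "{x. e + 1 *\<^sub>R x \<in> O'}"] assms(2) by auto
  \<comment> \<open>\<open>U\<close> is e + V / 2. The factor leaves room for the closure: for x in
    \<open>closure U\<close> some y in \<open>U\<close> has 2(x - y) in V, and averaging with 2(y -
    e) puts x - e into V.\<close>
  define U where "U = {x. - 2 *\<^sub>R e + 2 *\<^sub>R x \<in> V}"
  have "convex U"
  proof (rule convexI)
    fix x y and u v :: real
    assume *: "x \<in> U" "y \<in> U" "0 \<le> u" "0 \<le> v" "u + v = 1"
    then have "- 2 *\<^sub>R e + 2 *\<^sub>R x \<in> V" "- 2 *\<^sub>R e + 2 *\<^sub>R y \<in> V"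
      by (simp_all add: U_def)
    then have "u *\<^sub>R (- 2 *\<^sub>R e + 2 *\<^sub>R x) + v *\<^sub>R (- 2 *\<^sub>R e + 2 *\<^sub>R y) \<in> V"
      by (rule convexD[OF V(4)]) (use * in auto)
    also have "u *\<^sub>R (- 2 *\<^sub>R e + 2 *\<^sub>R x) + v *\<^sub>R (- 2 *\<^sub>R e + 2 *\<^sub>R y)
        = - 2 *\<^sub>R ((u + v) *\<^sub>R e) + 2 *\<^sub>R (u *\<^sub>R x + v *\<^sub>R y)"
      by (simp add: algebra_simps)
    finally show "u *\<^sub>R x + v *\<^sub>R y \<in> U" using * by (simp add: U_def)
  qed
  moreover have "closure U \<subseteq> O'"
  proof
    fix x assume x: "x \<in> closure U"
    have "open {y. 2 *\<^sub>R x + (- 2) *\<^sub>R y \<in> V}" by (rule open_affine_vimage[OF V(1)])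
    moreover have "x \<in> {y. 2 *\<^sub>R x + (- 2) *\<^sub>R y \<in> V}" using V(2) by simp
    ultimately obtain y where y: "y \<in> U" "2 *\<^sub>R x + (- 2) *\<^sub>R y \<in> V"
      using closure_meets_open[OF x] by blast
    have "- 2 *\<^sub>R e + 2 *\<^sub>R y \<in> V" using y(1) by (simp only: U_def mem_Collect_eq)
    then have "(1/2) *\<^sub>R (- 2 *\<^sub>R e + 2 *\<^sub>R y) + (1/2) *\<^sub>R (2 *\<^sub>R x + (- 2) *\<^sub>R y) \<in> V"
      by (rule convexD[OF V(4) _ y(2)]) simp_all
    then have "x - e \<in> V" by (simp add: scaleR_add_right scaleR_diff_right)
    then show "x \<in> O'" using V(3) by auto
  qed
  moreover have "open U" unfolding U_def by (rule open_affine_vimage[OF V(1)])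
  moreover have "e \<in> U" using V(2) by (simp add: U_def)
  ultimately show thesis using that by blast
qed

text \<open>\<open>f\<close> is bounded on one relatively open piece around a point x0. A
  contraction towards x0 with some positive ratio moves any given point into that piece, and by
  compactness finitely many ratios suffice. Affineness carries the bound back at the cost of
  dividing by the ratio; the sum over \<open>D\<close> is a common bound.\<close>

lemma A_f_bounded:
  fixes X :: "'a::locally_convex_space set"
  assumes "compact X" and "convex X" and "affine_fun_on X f" and "fragmented_on X f"
  obtains B where "0 \<le> B" and "\<And>x. x \<in> X \<Longrightarrow> \<bar>f x\<bar> \<le> B"
proof (cases "X = {}")
  case False
  obtain O' where O': "open O'" "X \<inter> O' \<noteq> {}" "bounded (f ` (X \<inter> O'))"
    using fragmented_onD[OF assms(4) compact_imp_closed[OF assms(1)] order_refl False, of 1] by (metis zero_less_one)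
  then obtain x0 C where x0: "x0 \<in> X" "x0 \<in> O'" and C: "\<And>x. x \<in> X \<inter> O' \<Longrightarrow> \<bar>f x\<bar> \<le> C"
    by (auto simp: bounded_iff)
  have C0: "0 \<le> C" using C[of x0] x0 by auto
  have "\<exists>t::real. 0 < t \<and> t \<le> 1 \<and> x0 + t *\<^sub>R (x - x0) \<in> O'" for x
    using ex_affine_shift_mem_open[OF O'(1) x0(2)] by metis
  then obtain t :: "'a \<Rightarrow> real"
    where t: "\<And>x. 0 < t x" "\<And>x. t x \<le> 1" "\<And>x. x0 + t x *\<^sub>R (x - x0) \<in> O'" by metis
  define N where "N x = {y. (1 - t x) *\<^sub>R x0 + t x *\<^sub>R y \<in> O'}" for x
  have "x \<in> N x" for x using t(3)[of x] by (simp add: N_def algebra_simps)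
  moreover have "open (N x)" for x unfolding N_def by (rule open_affine_vimage[OF O'(1)])
  ultimately obtain D where D: "finite D" "D \<subseteq> X" "X \<subseteq> (\<Union>x\<in>D. N x)"
    using compactE_image[OF assms(1), of X N] by (metis UN_I subsetI)
  show ?thesis
  proof (rule that)
    show "0 \<le> (\<Sum>x\<in>D. 2 * C / t x)"
      using t(1) C0 by (intro sum_nonneg) (simp add: less_imp_le)
    fix y assume y: "y \<in> X"
    then obtain x where x: "x \<in> D" "y \<in> N x" using D by blast
    let ?z = "(1 - t x) *\<^sub>R x0 + t x *\<^sub>R y"
    have "?z \<in> X \<inter> O'"
      using x y x0 t[of x] convexD[OF assms(2) x0(1) y, of "1 - t x" "t x"] by (simp add: N_def)
    then have "\<bar>f ?z\<bar> \<le> C" by (rule C)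
    moreover have "f ?z = (1 - t x) * f x0 + t x * f y"
      using y x0 t by (intro affine_fun_onD[OF assms(3)]) (auto intro: less_imp_le)
    moreover have "\<bar>(1 - t x) * f x0\<bar> \<le> 1 * C"
      unfolding abs_mult using C x0 t by (intro mult_mono) (auto intro: less_imp_le)
    ultimately have "\<bar>t x * f y\<bar> \<le> 2 * C" by linarith
    then have "\<bar>f y\<bar> \<le> 2 * C / t x"
      using t(1)[of x] by (simp add: abs_mult field_simps)
    also have "\<dots> \<le> (\<Sum>x\<in>D. 2 * C / t x)"
      using x D(1) C0 less_imp_le[OF t(1)] by (intro member_le_sum) auto
    finally show "\<bar>f y\<bar> \<le> (\<Sum>x\<in>D. 2 * C / t x)" .
  qed
qed (use that[of 0] in auto)

text \<open>Replaces the barycentric formula for fragmented affine functions: otherwise both \<open>{f \<le> b}\<close> and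
  \<open>{f \<ge> c}\<close> would be dense in the closed convex hull of \<open>E\<close>.\<close>

lemma fragmented_affine_hull_less:
  fixes X :: "'a::locally_convex_space set"
  assumes X: "compact X" "convex X" and f: "affine_fun_on X f" "fragmented_on X f"
    and E: "E \<subseteq> X" "E \<noteq> {}" "\<And>e. e \<in> E \<Longrightarrow> f e \<le> b" and "b < c"
  obtains U where "open U" and "E \<inter> U \<noteq> {}"
    and "\<And>q. q \<in> closure (convex hull (E \<inter> U)) \<Longrightarrow> f q < c"
proof (rule ccontr)
  assume no: "\<not> thesis"
  have ex: "\<exists>q. q \<in> closure (convex hull (E \<inter> U)) \<and> \<not> f q < c" if "open U" "E \<inter> U \<noteq> {}" for U
    using no \<open>\<And>U. open U \<Longrightarrow> E \<inter> U \<noteq> {} \<Longrightarrow> (\<And>q. q \<in> closure (convex hull (E \<inter> U)) \<Longrightarrow> f q < c) \<Longrightarrow> thesis\<close> that by blast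
  define N where "N = closure (convex hull E)"
  have "N \<subseteq> X"
    unfolding N_def using X E(1) by (simp add: closure_minimal hull_minimal compact_imp_closed)
  have "convex N" unfolding N_def by (intro convex_closure_lcs convex_convex_hull)
  \<comment> \<open>By the assumption to be refuted, the closed hull of every piece of
    \<open>E\<close> has a point with value at least \<open>c\<close>. Pieces cut out by convex
    neighbourhoods with small closure have hulls near any prescribed point of \<open>E\<close>, so
    \<open>E\<close> lies in \<open>closure D\<close>; convexity extends this to the hull of
    \<open>E\<close>.\<close>
  define D where "D = N \<inter> {x \<in> X. c \<le> f x}"
  have "E \<subseteq> closure D"
  proof
    fix e assume e: "e \<in> E"
    show "e \<in> closure D"
      unfolding closure_iff_nhds_not_empty
    proof (intro allI impI)
      fix A V assume A: "V \<subseteq> A" "open V" "e \<in> V"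
      obtain U where U: "open U" "convex U" "e \<in> U" "closure U \<subseteq> V"
        using ex_convex_nhd[OF A(2,3)] by metis
      obtain q where q: "q \<in> closure (convex hull (E \<inter> U))" "\<not> f q < c"
        using ex[OF U(1)] e U(3) by blast
      have "convex hull (E \<inter> U) \<subseteq> U" by (rule hull_minimal) (use U(2) in auto)
      from closure_mono[OF this] have "q \<in> closure U" using q(1) by blast
      moreover have "q \<in> N"
        using q(1) closure_mono[OF hull_mono[OF Int_lower1]] unfolding N_def by blast
      ultimately show "D \<inter> A \<noteq> {}"
        using q(2) \<open>N \<subseteq> X\<close> U(4) A(1) unfolding D_def by force
    qed
  qed
  moreover have "convex (closure D)"
    unfolding D_def by (intro convex_closure_lcs convex_Int \<open>convex N\<close> convex_affine_ge[OF f(1) X(2)])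
  ultimately have hull: "convex hull E \<subseteq> closure D"
    by (rule hull_minimal)
  obtain O' where O': "open O'" "N \<inter> O' \<noteq> {}"
    "\<And>x y. x \<in> N \<inter> O' \<Longrightarrow> y \<in> N \<inter> O' \<Longrightarrow> \<bar>f x - f y\<bar> < c - b"
  proof (rule fragmented_onD[OF f(2) _ \<open>N \<subseteq> X\<close>])
    show "closed N" "N \<noteq> {}" using E(2) by (simp_all add: N_def)
    show "0 < c - b" using \<open>b < c\<close> by simp
  qed blast
  have "O' \<inter> convex hull E \<noteq> {}"
    using O'(1,2) unfolding N_def by (metis Int_commute open_Int_closure_eq_empty)
  then obtain p where p: "p \<in> convex hull E" "p \<in> O'" by blast
  have "O' \<inter> D \<noteq> {}"
    using p hull O'(1) by (metis disjoint_iff open_Int_closure_eq_empty subsetD)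
  then obtain q where "q \<in> O'" "q \<in> D" by blast
  moreover have "f p \<le> b"
    using affine_convex_hull_le[OF f(1) X(2) E(1,3) p(1)] .
  moreover have "p \<in> N" using p(1) closure_subset unfolding N_def by blast
  ultimately show False
    using O'(3)[of q p] p(2) by (auto simp: D_def)
qed

text \<open>Restricting \<open>E\<close> to a piece where \<open>f\<close> varies by less than
  \<epsilon> / 4 gives one-sided bounds around the value at a point e. The previous lemma, used for
  \<open>f\<close> and then for \<open>- f\<close> on the shrunken piece, carries them to the closed
  hull with loss \<epsilon> / 4 each.\<close>

lemma fragmented_affine_hull_osc:
  fixes X :: "'a::locally_convex_space set"
  assumes X: "compact X" "convex X" and f: "affine_fun_on X f" "fragmented_on X f"
    and E: "closed E" "E \<subseteq> X" "E \<noteq> {}" and "0 < \<epsilon>"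
  obtains U where "open U" and "E \<inter> U \<noteq> {}"
    and "\<And>p q. p \<in> closure (convex hull (E \<inter> U)) \<Longrightarrow> q \<in> closure (convex hull (E \<inter> U)) \<Longrightarrow>
      \<bar>f p - f q\<bar> < \<epsilon>"
proof -
  obtain O' where O': "open O'" "E \<inter> O' \<noteq> {}"
    "\<And>x y. x \<in> E \<inter> O' \<Longrightarrow> y \<in> E \<inter> O' \<Longrightarrow> \<bar>f x - f y\<bar> < \<epsilon> / 4"
  proof (rule fragmented_onD[OF f(2) E])
    show "0 < \<epsilon> / 4" using \<open>0 < \<epsilon>\<close> by simp
  qed blast
  then obtain e where e: "e \<in> E \<inter> O'" by blast
  have e': "\<bar>f x - f e\<bar> < \<epsilon> / 4" if "x \<in> E \<inter> O'" for x
    using O'(3) that e by blast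
  obtain U1 where U1: "open U1" "E \<inter> O' \<inter> U1 \<noteq> {}"
    "\<And>q. q \<in> closure (convex hull (E \<inter> O' \<inter> U1)) \<Longrightarrow> f q < f e + \<epsilon> / 2"
  proof (rule fragmented_affine_hull_less[OF X f])
    show "E \<inter> O' \<subseteq> X" "E \<inter> O' \<noteq> {}" using E O' by auto
    show "f x \<le> f e + \<epsilon> / 4" if "x \<in> E \<inter> O'" for x using e'[OF that] by linarith
    show "f e + \<epsilon> / 4 < f e + \<epsilon> / 2" using \<open>0 < \<epsilon>\<close> by simp
  qed blast
  obtain U2 where U2: "open U2" "E \<inter> O' \<inter> U1 \<inter> U2 \<noteq> {}"
    "\<And>q. q \<in> closure (convex hull (E \<inter> O' \<inter> U1 \<inter> U2)) \<Longrightarrow> - f q < - f e + \<epsilon> / 2"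
  proof (rule fragmented_affine_hull_less[OF X affine_fun_on_uminus[OF f(1)] fragmented_on_uminus[OF f(2)]])
    show "E \<inter> O' \<inter> U1 \<subseteq> X" "E \<inter> O' \<inter> U1 \<noteq> {}" using E U1 by auto
    show "- f x \<le> - f e + \<epsilon> / 4" if "x \<in> E \<inter> O' \<inter> U1" for x
    proof -
      have "x \<in> E \<inter> O'" using that by blast
      from e'[OF this] show ?thesis by linarith
    qed
    show "- f e + \<epsilon> / 4 < - f e + \<epsilon> / 2" using \<open>0 < \<epsilon>\<close> by simp
  qed blast
  show thesis
  proof (rule that)
    show "open (O' \<inter> U1 \<inter> U2)" using O' U1 U2 by blast
    show "E \<inter> (O' \<inter> U1 \<inter> U2) \<noteq> {}" using U2(2) by blast
    fix p q
    assume "p \<in> closure (convex hull (E \<inter> (O' \<inter> U1 \<inter> U2)))"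
      and "q \<in> closure (convex hull (E \<inter> (O' \<inter> U1 \<inter> U2)))"
    moreover have "closure (convex hull (E \<inter> O' \<inter> U1 \<inter> U2)) \<subseteq> closure (convex hull (E \<inter> O' \<inter> U1))"
      by (intro closure_mono hull_mono) blast
    ultimately have "f p < f e + \<epsilon> / 2" "f q < f e + \<epsilon> / 2" "- f p < - f e + \<epsilon> / 2" "- f q < - f e + \<epsilon> / 2"
      using U1(3) U2(3) by (auto simp: Int_assoc)
    then show "\<bar>f p - f q\<bar> < \<epsilon>" by linarith
  qed
qed

text \<open>The hypothesis \<open>no\<close> says that 0 misses the compact convex set y + \<tau>(X
  - X) - Q. A functional positive there separates y from Q by a margin larger than \<tau> times its
  oscillation on X, so the margin survives normalisation to size r.\<close>

lemma ex_separating_affine: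
  fixes X :: "'a::locally_convex_space set"
  assumes X: "compact X" "convex X" and Q: "compact Q" "convex Q" "Q \<subseteq> X" "Q \<noteq> {}"
    and y: "y \<in> X" and "0 < r"
    and no: "\<forall>q\<in>Q. \<forall>s\<in>X. \<forall>t\<in>X. q \<noteq> y + \<tau> *\<^sub>R (s - t)"
  shows "\<exists>\<psi>. continuous_on X \<psi> \<and> affine_fun_on X \<psi> \<and> (\<forall>x\<in>X. \<bar>\<psi> x\<bar> \<le> r) \<and>
    \<psi> y = 0 \<and> (\<forall>q\<in>Q. \<psi> q < - (\<tau> * r))"
proof -
  define g where "g p = y + \<tau> *\<^sub>R (fst (snd p) - snd (snd p)) - fst p" for p :: "'a \<times> 'a \<times> 'a"
  define C where "C = g ` (Q \<times> X \<times> X)"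
  have "continuous_on (Q \<times> X \<times> X) g"
    unfolding g_def by (intro continuous_intros)
  then have "compact C"
    unfolding C_def using X(1) Q(1) by (intro compact_continuous_image compact_Times)
  moreover have "convex C"
  proof (rule convexI)
    fix a b and u v :: real
    assume *: "a \<in> C" "b \<in> C" "0 \<le> u" "0 \<le> v" "u + v = 1"
    then obtain p p' where p: "p \<in> Q \<times> X \<times> X" "p' \<in> Q \<times> X \<times> X" "a = g p" "b = g p'"
      unfolding C_def by blast
    let ?c = "\<tau> *\<^sub>R ((u *\<^sub>R fst (snd p) + v *\<^sub>R fst (snd p')) - (u *\<^sub>R snd (snd p) + v *\<^sub>R snd (snd p')))
        - (u *\<^sub>R fst p + v *\<^sub>R fst p')"
    have "u *\<^sub>R a + v *\<^sub>R b = (u + v) *\<^sub>R y + ?c"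
      unfolding p(3,4) g_def by (simp add: algebra_simps)
    moreover have "g (u *\<^sub>R p + v *\<^sub>R p') = y + ?c"
      unfolding g_def by (simp add: algebra_simps)
    ultimately have "u *\<^sub>R a + v *\<^sub>R b = g (u *\<^sub>R p + v *\<^sub>R p')"
      unfolding *(5) scaleR_one by metis
    moreover have "u *\<^sub>R p + v *\<^sub>R p' \<in> Q \<times> X \<times> X"
      using *(3-5) p(1,2) Q(2) X(2) by (intro convexD convex_Times)
    ultimately show "u *\<^sub>R a + v *\<^sub>R b \<in> C"
      unfolding C_def by (metis imageI)
  qed
  moreover have "0 \<notin> C"
  proof
    assume "0 \<in> C"
    then obtain q s t where "q \<in> Q" "s \<in> X" "t \<in> X" "0 = g (q, s, t)"
      unfolding C_def by auto
    moreover from this have "q = y + \<tau> *\<^sub>R (s - t)" by (simp add: g_def)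
    ultimately show False using no by blast
  qed
  ultimately obtain \<phi> :: "'a \<Rightarrow> real" where \<phi>: "linear \<phi>" "continuous_on UNIV \<phi>" "\<And>x. x \<in> C \<Longrightarrow> 0 < \<phi> x"
    using hahn_banach_compact by metis
  have gt: "\<tau> * (\<phi> t - \<phi> s) < \<phi> y - \<phi> q" if "q \<in> Q" "s \<in> X" "t \<in> X" for q s t
  proof -
    have "0 < \<phi> (g (q, s, t))" using that by (intro \<phi>(3)) (auto simp: C_def)
    then show ?thesis
      by (simp add: g_def linear_add[OF \<phi>(1)] linear_diff[OF \<phi>(1)] linear_scale[OF \<phi>(1)] linear_diff[OF \<phi>(1)] algebra_simps)
  qed
  have cont: "continuous_on X \<phi>" using \<phi>(2) continuous_on_subset by blast
  then have "continuous_on X (\<lambda>x. \<bar>\<phi> x - \<phi> y\<bar>)" by (intro continuous_intros)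
  then obtain s where s: "s \<in> X" "\<And>x. x \<in> X \<Longrightarrow> \<bar>\<phi> x - \<phi> y\<bar> \<le> \<bar>\<phi> s - \<phi> y\<bar>"
    using continuous_attains_sup[OF X(1)] y by blast
  \<comment> \<open>The largest deviation from \<open>\<phi> y\<close>, attained at s. Depending on
    its sign, the pair (y, s) or (s, y) in \<open>gt\<close> turns it into a lower bound for the
    margin.\<close>
  define B where "B = \<bar>\<phi> s - \<phi> y\<bar>"
  have gtB: "\<phi> q - \<phi> y < - (\<tau> * B)" if "q \<in> Q" for q
    using gt[OF that y s(1)] gt[OF that s(1) y]
    unfolding B_def by (cases "\<phi> y \<le> \<phi> s") (auto simp: abs_if)
  obtain q where q: "q \<in> Q" using Q(4) by blast
  have "\<phi> q < \<phi> y" using gt[OF q y y] by simp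
  then have "0 < B" using s(2)[of q] q Q(3) unfolding B_def by auto
  define \<psi> where "\<psi> x = (r / B) * (\<phi> x - \<phi> y)" for x
  show ?thesis
  proof (intro exI[of _ \<psi>] conjI ballI)
    show "continuous_on X \<psi>" unfolding \<psi>_def by (intro continuous_intros cont)
    show "affine_fun_on X \<psi>"
      unfolding \<psi>_def
      by (intro affine_fun_on_cmult affine_fun_on_diff)
        (simp_all add: affine_fun_on_def linear_add[OF \<phi>(1)] linear_scale[OF \<phi>(1)] linear_diff[OF \<phi>(1)] algebra_simps)
    show "\<bar>\<psi> x\<bar> \<le> r" if "x \<in> X" for x
    proof -
      have "\<bar>\<psi> x\<bar> \<le> (r / B) * B"
        unfolding \<psi>_def abs_mult using s(2)[OF that] \<open>0 < B\<close> \<open>0 < r\<close>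
        by (intro mult_mono) (auto simp: B_def)
      then show ?thesis using \<open>0 < B\<close> by simp
    qed
    show "\<psi> y = 0" by (simp add: \<psi>_def)
    show "\<psi> q < - (\<tau> * r)" if "q \<in> Q" for q
    proof -
      have "\<psi> q < (r / B) * (- (\<tau> * B))"
        unfolding \<psi>_def using gtB[OF that] \<open>0 < B\<close> \<open>0 < r\<close> by (intro mult_strict_left_mono) auto
      then show ?thesis using \<open>0 < B\<close> by (simp add: mult.commute)
    qed
  qed
qed

section \<open>Perturbations and almost maximal points\<close>

text \<open>Comparing with every other value avoids \<open>Sup\<close> and its boundedness side
  conditions; d = 0 gives the exact maximisers.\<close>

definition near_max :: "'a set \<Rightarrow> ('a \<Rightarrow> real) \<Rightarrow> real \<Rightarrow> 'a set" where
  "near_max X h d = {x \<in> X. \<forall>y\<in>X. h y \<le> h x + d}"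

lemma near_max_subset: "near_max X h d \<subseteq> X"
  by (auto simp: near_max_def)

lemma near_max_perturb:
  assumes "\<And>x. x \<in> X \<Longrightarrow> \<bar>g x - h x\<bar> \<le> r" and "d + 2 * r \<le> d'"
  shows "near_max X g d \<subseteq> near_max X h d'"
proof
  fix x assume x: "x \<in> near_max X g d"
  have "h y \<le> h x + d'" if "y \<in> X" for y
    using assms(1)[of x] assms(1)[of y] assms(2) that x by (force simp: near_max_def abs_le_iff)
  then show "x \<in> near_max X h d'" using x by (simp add: near_max_def)
qed

lemma near_max_nonempty:
  assumes "X \<noteq> {}" and "\<And>x. x \<in> X \<Longrightarrow> h x \<le> B" and "0 < d"
  shows "near_max X h d \<noteq> {}"
proof -
  have bdd: "bdd_above (h ` X)" using assms(2) unfolding bdd_above_def by auto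
  obtain x where x: "x \<in> X" "Sup (h ` X) - d < h x"
    using less_cSupD[of "h ` X" "Sup (h ` X) - d"] assms by auto
  have "h y \<le> h x + d" if "y \<in> X" for y
    using cSup_upper[OF imageI[OF that] bdd] x by linarith
  with x show ?thesis by (auto simp: near_max_def)
qed

text \<open>The shift itself is no convex combination. Writing it as y + \<tau> s = q + \<tau> t and
  dividing by 1 + \<tau> makes both sides convex combinations of points of X, to which affineness on
  X applies.\<close>

lemma affine_fun_on_shift_le:
  assumes "convex X" and f: "affine_fun_on X f" and "\<And>x. x \<in> X \<Longrightarrow> \<bar>f x\<bar> \<le> B"
    and mem: "q \<in> X" "y \<in> X" "s \<in> X" "t \<in> X" and "q = y + \<tau> *\<^sub>R (s - t)" and "0 \<le> \<tau>"
  shows "\<bar>f y - f q\<bar> \<le> 2 * \<tau> * B"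
proof -
  let ?u = "1 / (1 + \<tau>)" and ?v = "\<tau> / (1 + \<tau>)"
  have uv: "0 \<le> ?u" "0 \<le> ?v" "?u + ?v = 1"
    using \<open>0 \<le> \<tau>\<close> by (auto simp flip: add_divide_distrib)
  have "?u *\<^sub>R y + ?v *\<^sub>R s = ?u *\<^sub>R (y + \<tau> *\<^sub>R s)"
    by (simp add: scaleR_add_right)
  also have "y + \<tau> *\<^sub>R s = q + \<tau> *\<^sub>R t"
    using assms(8) by (simp add: algebra_simps)
  finally have "f (?u *\<^sub>R y + ?v *\<^sub>R s) = f (?u *\<^sub>R q + ?v *\<^sub>R t)"
    by (simp add: scaleR_add_right)
  then have "?u * f y + ?v * f s = ?u * f q + ?v * f t"
    using affine_fun_onD[OF f _ _ uv] mem by simp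
  moreover have "(1 + \<tau>) * (?u * a + ?v * b) = a + \<tau> * b" for a b
  proof -
    have "(1 + \<tau>) * ?u = 1" "(1 + \<tau>) * ?v = \<tau>" using \<open>0 \<le> \<tau>\<close> by auto
    then show ?thesis by (metis distrib_left mult.assoc mult_1)
  qed
  ultimately have "f y + \<tau> * f s = f q + \<tau> * f t"
    by metis
  then have "f y - f q = \<tau> * (f t - f s)"
    by (simp add: right_diff_distrib)
  then have "\<bar>f y - f q\<bar> = \<tau> * \<bar>f t - f s\<bar>"
    using \<open>0 \<le> \<tau>\<close> by (simp add: abs_mult)
  also have "\<dots> \<le> \<tau> * (2 * B)"
    using assms(3)[OF mem(3)] assms(3)[OF mem(4)] \<open>0 \<le> \<tau>\<close> by (intro mult_left_mono) auto
  finally show ?thesis by (simp add: mult_ac)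
qed

text \<open>The set \<open>E\<close> below is a minimal closed set adherent to the almost maximal points of all small
  continuous affine perturbations of \<open>h\<close>. By minimality, for any open \<open>U\<close> meeting \<open>E\<close> some perturbation
  has its almost maximal points adherent to \<open>E\<close> only inside \<open>U\<close>, and this persists under further
  perturbation; by separation its almost maximal points then lie in \<open>Q + \<tau> (X - X)\<close>, where \<open>Q\<close> is
  the closed convex hull of \<open>E \<inter> U\<close> and \<open>\<tau>\<close> is small.\<close>

lemma ex_perturbation_small_osc:
  fixes X :: "'a::locally_convex_space set"
  assumes X: "compact X" "convex X" "X \<noteq> {}" and f: "affine_fun_on X f" "fragmented_on X f"
    and h: "\<And>x. x \<in> X \<Longrightarrow> h x \<le> H" and "0 < d" and "0 < \<epsilon>"
  obtains a d' where "continuous_on X a" and "affine_fun_on X a"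
    and "\<And>x. x \<in> X \<Longrightarrow> \<bar>a x\<bar> \<le> d / 8" and "0 < d'" and "d' \<le> d / 2"
    and "\<And>x y. x \<in> closure (near_max X (\<lambda>x. h x + a x) d') \<Longrightarrow>
      y \<in> closure (near_max X (\<lambda>x. h x + a x) d') \<Longrightarrow> \<bar>f x - f y\<bar> \<le> \<epsilon>"
proof -
  have clX: "closed X" using X(1) by (rule compact_imp_closed)
  have nmX: "closure (near_max X g e) \<subseteq> X" for g e
    by (rule closure_minimal[OF near_max_subset clX])
  define \<P> where "\<P> r = {a. continuous_on X a \<and> affine_fun_on X a \<and> (\<forall>x\<in>X. \<bar>a x\<bar> \<le> r)}" for r :: real
  \<comment> \<open>The strict bound r < d / 8 leaves room for a further small perturbation on top
    of a given one.\<close>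
  define \<S> where "\<S> = {E. closed E \<and> E \<subseteq> X \<and> (\<forall>r<d/8. \<forall>a\<in>\<P> r. \<forall>\<delta>>0.
    closure (near_max X (\<lambda>x. h x + a x) \<delta>) \<inter> E \<noteq> {})}"
  have "\<exists>E\<in>\<S>. \<forall>N\<in>\<S>. N \<subseteq> E \<longrightarrow> N = E"
  proof (rule ex_minimal_set)
    have "closure (near_max X (\<lambda>x. h x + a x) \<delta>) \<inter> X \<noteq> {}" if "a \<in> \<P> r" "\<delta> > 0" for a r \<delta>
    proof -
      have "h x + a x \<le> H + r" if "x \<in> X" for x
        using h[OF that] \<open>a \<in> \<P> r\<close> that by (force simp: \<P>_def abs_le_iff)
      from near_max_nonempty[OF X(3) this \<open>\<delta> > 0\<close>] show ?thesis
        using nmX closure_subset by (simp add: Int_absorb2)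
    qed
    then show "X \<in> \<S>" using clX by (simp add: \<S>_def)
  next
    fix \<C> assume C: "\<C> \<noteq> {}" "\<C> \<subseteq> \<S>" "\<And>S T. S \<in> \<C> \<Longrightarrow> T \<in> \<C> \<Longrightarrow> S \<subseteq> T \<or> T \<subseteq> S"
    have cl: "closed E" "E \<subseteq> X" if "E \<in> \<C>" for E using C(2) that by (auto simp: \<S>_def)
    have "closure (near_max X (\<lambda>x. h x + a x) \<delta>) \<inter> \<Inter>\<C> \<noteq> {}"
      if "r < d / 8" "a \<in> \<P> r" "\<delta> > 0" for r a \<delta>
    proof (rule compact_Int_chain_nonempty[OF _ C(1) _ _ C(3)])
      have "compact (X \<inter> closure (near_max X (\<lambda>x. h x + a x) \<delta>))"
        using X(1) by (rule compact_Int_closed) simp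
      then show "compact (closure (near_max X (\<lambda>x. h x + a x) \<delta>))"
        using nmX by (simp add: Int_absorb1)
      show "closure (near_max X (\<lambda>x. h x + a x) \<delta>) \<inter> S \<noteq> {}" if "S \<in> \<C>" for S
        using C(2) that \<open>r < d / 8\<close> \<open>a \<in> \<P> r\<close> \<open>\<delta> > 0\<close> unfolding \<S>_def by blast
    qed (use cl in auto)
    moreover have "\<Inter>\<C> \<subseteq> X" using C(1) cl(2) by blast
    moreover have "closed (\<Inter>\<C>)" using cl(1) by blast
    ultimately show "\<Inter>\<C> \<in> \<S>" unfolding \<S>_def by blast
  qed
  then obtain E where E: "E \<in> \<S>" and min: "\<And>N. N \<in> \<S> \<Longrightarrow> N \<subseteq> E \<Longrightarrow> N = E" by blast
  from E have E': "closed E" "E \<subseteq> X"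
    and meets: "\<And>r a \<delta>. r < d / 8 \<Longrightarrow> a \<in> \<P> r \<Longrightarrow> \<delta> > 0 \<Longrightarrow>
      closure (near_max X (\<lambda>x. h x + a x) \<delta>) \<inter> E \<noteq> {}"
    unfolding \<S>_def by blast+
  have "(\<lambda>x. 0) \<in> \<P> 0" by (simp add: \<P>_def affine_fun_on_def)
  then have "E \<noteq> {}" using meets[of 0 "\<lambda>x. 0" 1] \<open>0 < d\<close> by auto
  obtain U where U: "open U" "E \<inter> U \<noteq> {}"
    and osc: "\<And>p q. p \<in> closure (convex hull (E \<inter> U)) \<Longrightarrow> q \<in> closure (convex hull (E \<inter> U)) \<Longrightarrow>
      \<bar>f p - f q\<bar> < \<epsilon> / 2"
  proof (rule fragmented_affine_hull_osc[OF X(1,2) f E' \<open>E \<noteq> {}\<close>])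
    show "0 < \<epsilon> / 2" using \<open>0 < \<epsilon>\<close> by simp
  qed blast
  have "E - U \<notin> \<S>"
    using min[of "E - U"] U(2) by blast
  then have "\<exists>r<d/8. \<exists>a\<in>\<P> r. \<exists>\<delta>>0. closure (near_max X (\<lambda>x. h x + a x) \<delta>) \<inter> (E - U) = {}"
    using E' U(1) unfolding \<S>_def by blast
  then obtain r a \<delta> where a: "r < d / 8" "a \<in> \<P> r" "\<delta> > 0"
    and sub: "closure (near_max X (\<lambda>x. h x + a x) \<delta>) \<inter> (E - U) = {}"
    by blast
  let ?h = "\<lambda>x. h x + a x"
  have "0 \<le> r" using X(3) a(2) by (force simp: \<P>_def)
  obtain B where B: "0 \<le> B" "\<And>x. x \<in> X \<Longrightarrow> \<bar>f x\<bar> \<le> B"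
    using A_f_bounded[OF X(1,2) f] by blast
  define \<tau> where "\<tau> = \<epsilon> / (8 * (B + 1))"
  have \<tau>: "0 < \<tau>" "2 * \<tau> * B \<le> \<epsilon> / 4"
    using B(1) \<open>0 < \<epsilon>\<close> by (auto simp: \<tau>_def divide_simps)
  \<comment> \<open>The first term keeps r + r' below d / 8; the second, with \<eta> at most
    \<delta> / 2 below, gives \<eta> + 2 r' \<le> \<delta>, as \<open>near_max_perturb\<close>
    requires.\<close>
  define r' where "r' = min (d / 16 - r / 2) (\<delta> / 4)"
  have r': "0 < r'" "r + r' < d / 8" "r' \<le> \<delta> / 4"
  proof -
    have "r' \<le> d / 16 - r / 2" unfolding r'_def by (rule min.cobounded1)
    with a(1) show "r + r' < d / 8" by linarith
    show "r' \<le> \<delta> / 4" unfolding r'_def by (rule min.cobounded2)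
    have "0 < d / 16 - r / 2" "0 < \<delta> / 4" using a by linarith+
    then show "0 < r'" unfolding r'_def by (rule min_less_iff_conj[THEN iffD2, OF conjI])
  qed
  \<comment> \<open>Together with \<eta> below, d' amounts to at most 3/4 of \<tau> r', less than
    the penalty that \<psi> imposes on Q.\<close>
  define d' where "d' = min (d / 2) (\<tau> * r' / 2)"
  have d': "0 < d'" "d' \<le> d / 2" "d' \<le> \<tau> * r' / 2"
    unfolding d'_def using \<open>0 < d\<close> mult_pos_pos[OF \<tau>(1) r'(1)] by (simp_all add: min_def)
  define Q where "Q = closure (convex hull (E \<inter> U))"
  have "Q \<subseteq> X"
    unfolding Q_def using E'(2) X(2) by (intro closure_minimal[OF hull_minimal clX]) auto
  then have Q: "compact Q" "convex Q" "Q \<noteq> {}"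
    using compact_Int_closed[OF X(1), of Q] U(2)
    by (auto simp: Q_def Int_absorb1 intro: convex_closure_lcs)
  have EUQ: "E \<inter> U \<subseteq> Q"
    unfolding Q_def using hull_subset closure_subset by (rule order_trans)
  \<comment> \<open>If y stayed away from the thickened Q, then \<psi> would penalise Q but not y.
    Yet the almost maximal points after adding \<psi> still accumulate at a point of
    \<open>E\<close>, which must lie in \<open>U\<close> and hence in Q; nearby ones would lose too
    much against y.\<close>
  have step: "\<exists>q\<in>Q. \<exists>s\<in>X. \<exists>t\<in>X. q = y + \<tau> *\<^sub>R (s - t)" if y: "y \<in> near_max X ?h d'" for y
  proof (rule ccontr)
    assume "\<not> ?thesis"
    then have no: "\<forall>q\<in>Q. \<forall>s\<in>X. \<forall>t\<in>X. q \<noteq> y + \<tau> *\<^sub>R (s - t)" by blast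
    have yX: "y \<in> X" using near_max_subset y by (rule subsetD)
    from ex_separating_affine[OF X(1,2) Q(1,2) \<open>Q \<subseteq> X\<close> Q(3) yX r'(1) no] obtain \<psi> where
      \<psi>: "continuous_on X \<psi>" "affine_fun_on X \<psi>" "\<And>x. x \<in> X \<Longrightarrow> \<bar>\<psi> x\<bar> \<le> r'"
      "\<psi> y = 0" "\<And>q. q \<in> Q \<Longrightarrow> \<psi> q < - (\<tau> * r')"
      by blast
    define \<eta> where "\<eta> = min (\<delta> / 2) (\<tau> * r' / 4)"
    have \<eta>: "0 < \<eta>" "\<eta> \<le> \<delta> / 2" "\<eta> \<le> \<tau> * r' / 4"
      unfolding \<eta>_def using a(3) mult_pos_pos[OF \<tau>(1) r'(1)] by (simp_all add: min_def)
    let ?N = "near_max X (\<lambda>x. h x + (a x + \<psi> x)) \<eta>"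
    have "(\<lambda>x. a x + \<psi> x) \<in> \<P> (r + r')"
      using a(2) \<psi>(1-3) unfolding \<P>_def
      by (auto intro!: continuous_intros affine_fun_on_add intro: order_trans[OF abs_triangle_ineq] add_mono)
    from meets[OF r'(2) this \<eta>(1)] obtain w where w: "w \<in> closure ?N" "w \<in> E" by blast
    have "?N \<subseteq> near_max X ?h \<delta>"
      using \<psi>(3) r'(3) \<eta>(2) by (intro near_max_perturb[where r = r']) auto
    from closure_mono[OF this] have "w \<in> U" using w sub by blast
    then have wQ: "w \<in> Q" using w EUQ by blast
    then have "w \<in> X" using \<open>Q \<subseteq> X\<close> by blast
    from \<psi>(1)[unfolded continuous_on_topological, rule_format, OF this, of "{..< - (\<tau> * r')}"] \<psi>(5)[OF wQ]
    obtain V where V: "open V" "w \<in> V" "\<And>x. x \<in> X \<Longrightarrow> x \<in> V \<Longrightarrow> \<psi> x < - (\<tau> * r')"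
      by auto
    from closure_meets_open[OF w(1) V(1,2)] obtain x where x: "x \<in> ?N" "x \<in> V" .
    have xX: "x \<in> X" using near_max_subset x(1) by (rule subsetD)
    have "?h y + \<psi> y \<le> ?h x + \<psi> x + \<eta>"
      using x(1) yX by (simp add: near_max_def add.assoc)
    moreover have "?h x \<le> ?h y + d'" using y xX by (simp add: near_max_def)
    ultimately show False
      using V(3)[OF xX x(2)] \<psi>(4) \<eta>(3) d'(3) mult_pos_pos[OF \<tau>(1) r'(1)] by linarith
  qed
  \<comment> \<open>The thickened Q is compact, hence closed, so the estimate extends from the
    almost maximal points to their closure.\<close>
  define T where "T = (\<lambda>p. fst p - \<tau> *\<^sub>R (fst (snd p) - snd (snd p))) ` (Q \<times> X \<times> X)"
  have "compact T"
    unfolding T_def using Q(1) X(1)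
    by (intro compact_continuous_image compact_Times continuous_intros)
  have "near_max X ?h d' \<subseteq> T"
  proof
    fix y assume "y \<in> near_max X ?h d'"
    from step[OF this] obtain q s t where "q \<in> Q" "s \<in> X" "t \<in> X" "q = y + \<tau> *\<^sub>R (s - t)" by blast
    then show "y \<in> T" unfolding T_def by (intro image_eqI[of _ _ "(q, s, t)"]) auto
  qed
  then have clT: "closure (near_max X ?h d') \<subseteq> T"
    using compact_imp_closed[OF \<open>compact T\<close>] by (rule closure_minimal)
  have near: "\<exists>q\<in>Q. \<bar>f x - f q\<bar> \<le> \<epsilon> / 4" if "x \<in> closure (near_max X ?h d')" for x
  proof -
    have "x \<in> T" using clT that by (rule subsetD)
    then obtain q s t where q: "q \<in> Q" "s \<in> X" "t \<in> X" "x = q - \<tau> *\<^sub>R (s - t)"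
      unfolding T_def by auto
    have "x \<in> X" using nmX that by (rule subsetD)
    have "\<bar>f x - f q\<bar> \<le> 2 * \<tau> * B"
      using q \<open>x \<in> X\<close> \<open>Q \<subseteq> X\<close> \<tau>(1)
      by (intro affine_fun_on_shift_le[OF X(2) f(1) B(2), of q x s t]) auto
    then show ?thesis using q(1) \<tau>(2) by force
  qed
  show thesis
  proof (rule that)
    show "continuous_on X a" "affine_fun_on X a" using a(2) by (auto simp: \<P>_def)
    show "\<bar>a x\<bar> \<le> d / 8" if "x \<in> X" for x using a that by (force simp: \<P>_def)
    show "0 < d'" "d' \<le> d / 2" by fact+
    fix x y assume "x \<in> closure (near_max X ?h d')" "y \<in> closure (near_max X ?h d')"
    then obtain p q where "p \<in> Q" "q \<in> Q" "\<bar>f x - f p\<bar> \<le> \<epsilon> / 4" "\<bar>f y - f q\<bar> \<le> \<epsilon> / 4"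
      using near by blast
    then show "\<bar>f x - f y\<bar> \<le> \<epsilon>" using osc[of p q] unfolding Q_def by linarith
  qed
qed

section \<open>Functions generated by monotone limits\<close>

text \<open>A member of \<open>R\<close> is a smallness condition, given as the family of sets satisfying it.\<close>

definition controlled ::
    "'a::topological_space set \<Rightarrow> 'a set set set \<Rightarrow> ('a \<Rightarrow> real) \<Rightarrow> bool" where
  "controlled X R a \<longleftrightarrow> (\<forall>z\<in>X. \<forall>F. F \<le> nhds z \<longrightarrow> F \<le> principal X \<longrightarrow>
    (\<forall>P\<in>R. \<exists>M\<in>P. F \<le> principal M) \<longrightarrow> (a \<longlongrightarrow> a z) F)"

text \<open>The perturbation has to be controlled by the conditions themselves, because the limit of all
  perturbations must be controlled as well.\<close>

definition dense_family ::
    "'a::locally_convex_space set \<Rightarrow> 'a set set set \<Rightarrow> 'a set set \<Rightarrow> bool" where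
  "dense_family X R P \<longleftrightarrow> (\<forall>h H d. (\<forall>x\<in>X. h x \<le> H) \<longrightarrow> 0 < d \<longrightarrow>
    (\<exists>a d'. affine_fun_on X a \<and> controlled X R a \<and> (\<forall>x\<in>X. \<bar>a x\<bar> \<le> d / 8) \<and>
      0 < d' \<and> d' \<le> d / 2 \<and> near_max X (\<lambda>x. h x + a x) d' \<in> P))"

text \<open>Countability lets one sequence of perturbations meet all conditions, and nonemptiness
  lets \<open>from_nat_into\<close> enumerate them. The same \<open>R\<close> controls
  \<open>u\<close> and the perturbations that realise its members.\<close>

definition tame :: "'a::locally_convex_space set \<Rightarrow> ('a \<Rightarrow> real) \<Rightarrow> bool" where
  "tame X u \<longleftrightarrow> (\<exists>R. countable R \<and> R \<noteq> {} \<and> controlled X R u \<and> (\<forall>P\<in>R. dense_family X R P))"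

section \<open>Calculus of controlled functions and filters\<close>

lemma controlledI:
  assumes "\<And>z F. z \<in> X \<Longrightarrow> F \<le> nhds z \<Longrightarrow> F \<le> principal X \<Longrightarrow>
    \<forall>P\<in>R. \<exists>M\<in>P. F \<le> principal M \<Longrightarrow> (a \<longlongrightarrow> a z) F"
  shows "controlled X R a"
  using assms by (simp add: controlled_def)

lemma controlledD:
  assumes "controlled X R a" and "z \<in> X" and "F \<le> nhds z" and "F \<le> principal X"
    and "\<forall>P\<in>R. \<exists>M\<in>P. F \<le> principal M"
  shows "(a \<longlongrightarrow> a z) F"
  using assms(1)[unfolded controlled_def, THEN bspec, OF assms(2), THEN spec, THEN mp, OF assms(3),
      THEN mp, OF assms(4), THEN mp, OF assms(5)] .

lemma controlled_mono:
  assumes "controlled X R a" and "R \<subseteq> R'"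
  shows "controlled X R' a"
  using assms(2) by (intro controlledI controlledD[OF assms(1)]) auto

lemma dense_familyD:
  assumes "dense_family X R P" and "\<forall>x\<in>X. h x \<le> H" and "0 < d"
  shows "\<exists>a d'. affine_fun_on X a \<and> controlled X R a \<and> (\<forall>x\<in>X. \<bar>a x\<bar> \<le> d / 8) \<and>
      0 < d' \<and> d' \<le> d / 2 \<and> near_max X (\<lambda>x. h x + a x) d' \<in> P"
  using assms(1)[unfolded dense_family_def, THEN spec, THEN spec, THEN spec, THEN mp, THEN mp,
      OF assms(2,3)] .

text \<open>More conditions admit fewer filters, so control of the perturbation becomes weaker to
  demand.\<close>

lemma dense_family_mono:
  assumes "dense_family X R P" and "R \<subseteq> R'"
  shows "dense_family X R' P"
  unfolding dense_family_def
proof (intro allI impI)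
  fix h :: "'a \<Rightarrow> real" and H d :: real assume "\<forall>x\<in>X. h x \<le> H" "0 < d"
  from dense_familyD[OF assms(1) this] obtain a d' where "affine_fun_on X a" "controlled X R a" "\<forall>x\<in>X. \<bar>a x\<bar> \<le> d / 8"
    "0 < d'" "d' \<le> d / 2" "near_max X (\<lambda>x. h x + a x) d' \<in> P"
    by blast
  then show "\<exists>a d'. affine_fun_on X a \<and> controlled X R' a \<and> (\<forall>x\<in>X. \<bar>a x\<bar> \<le> d / 8) \<and>
      0 < d' \<and> d' \<le> d / 2 \<and> near_max X (\<lambda>x. h x + a x) d' \<in> P"
    using controlled_mono[OF _ assms(2)] by (intro exI[of _ a] exI[of _ d']) simp
qed

lemma controlled_add:
  assumes "controlled X R a" and "controlled X R b"
  shows "controlled X R (\<lambda>x. a x + b x)"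
  by (intro controlledI tendsto_add controlledD[OF assms(1)] controlledD[OF assms(2)])

lemma controlled_cmult:
  assumes "controlled X R a"
  shows "controlled X R (\<lambda>x. c * a x)"
  by (intro controlledI tendsto_mult_left controlledD[OF assms])

lemma tame_uminus: "tame X u \<Longrightarrow> tame X (\<lambda>x. - u x)"
  unfolding tame_def using controlled_cmult[of X _ u "-1"] by fastforce

lemma continuous_on_imp_controlled:
  assumes "continuous_on X a"
  shows "controlled X R a"
  unfolding controlled_def
proof (intro ballI allI impI topological_tendstoI)
  fix z F S assume *: "z \<in> X" "F \<le> nhds z" "F \<le> principal X" "open S" "a z \<in> S"
  then obtain A where A: "open A" "z \<in> A" "\<forall>y\<in>X. y \<in> A \<longrightarrow> a y \<in> S"
    using assms unfolding continuous_on_topological by metis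
  have "eventually (\<lambda>x. x \<in> A) F"
    using filter_leD[OF *(2) eventually_nhds_in_open[OF A(1,2)]] .
  moreover have "eventually (\<lambda>x. x \<in> X) F"
    using *(3) by (simp add: le_principal)
  ultimately show "eventually (\<lambda>x. a x \<in> S) F"
    by eventually_elim (use A(3) in blast)
qed

lemma mem_closure_filter:
  assumes "F \<noteq> bot" and "F \<le> nhds z" and "F \<le> principal M"
  shows "z \<in> closure M"
proof (rule ccontr)
  assume "z \<notin> closure M"
  then have "eventually (\<lambda>x. x \<in> - closure M) (nhds z)"
    by (intro eventually_nhds_in_open) auto
  then have "eventually (\<lambda>x. x \<in> - closure M) F"
    using assms(2) by (rule filter_leD[rotated])
  moreover have "eventually (\<lambda>x. x \<in> M) F"
    using assms(3) by (simp add: le_principal)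
  ultimately have "eventually (\<lambda>x. False) F"
    by eventually_elim (use closure_subset in blast)
  then show False using assms(1) by (simp add: eventually_False)
qed

lemma inf_nhds_principal_neq_bot:
  assumes "z \<in> closure A"
  shows "inf (nhds z) (principal A) \<noteq> bot"
proof
  assume "inf (nhds z) (principal A) = bot"
  then have "eventually (\<lambda>x. x \<notin> A) (nhds z)"
    unfolding trivial_limit_def eventually_inf_principal by simp
  then obtain S where "open S" "z \<in> S" "\<forall>x\<in>S. x \<notin> A"
    unfolding eventually_nhds by blast
  then show False using closure_meets_open[OF assms] by metis
qed

section \<open>Tameness of generators and of monotone limits\<close>

lemma A_f_tame:
  fixes X :: "'a::locally_convex_space set"
  assumes X: "compact X" "convex X" "X \<noteq> {}" and f: "affine_fun_on X f" "fragmented_on X f"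
  shows "tame X f"
proof -
  \<comment> \<open>The closure matters: the limit z of a filter on M lies only in
    \<open>closure M\<close>, and \<open>f z\<close> has to be compared with the values on
    M.\<close>
  define P where "P n = {M. \<forall>x\<in>closure M. \<forall>y\<in>closure M. \<bar>f x - f y\<bar> \<le> 1 / real (Suc n)}" for n
  have "controlled X (range P) f"
    unfolding controlled_def
  proof (intro ballI allI impI)
    fix z F assume z: "z \<in> X" "F \<le> nhds z" "F \<le> principal X"
      and M: "\<forall>P\<in>range P. \<exists>M\<in>P. F \<le> principal M"
    show "(f \<longlongrightarrow> f z) F"
    proof (cases "F = bot")
      case False
      show ?thesis
      proof (rule tendstoI)
        fix e :: real assume "0 < e"
        then obtain n where n: "1 / real (Suc n) < e"
          using nat_approx_posE by blast
        obtain M where M: "M \<in> P n" "F \<le> principal M" using M by blast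
        have "z \<in> closure M" using False z(2) M(2) by (rule mem_closure_filter)
        moreover have "eventually (\<lambda>x. x \<in> M) F" using M(2) by (simp add: le_principal)
        ultimately show "eventually (\<lambda>x. dist (f x) (f z) < e) F"
        proof (elim eventually_mono)
          fix x assume "x \<in> M"
          then have "x \<in> closure M" using closure_subset by blast
          then have "\<bar>f x - f z\<bar> \<le> 1 / real (Suc n)"
            using M(1) \<open>z \<in> closure M\<close> unfolding P_def by blast
          then show "dist (f x) (f z) < e" using n by (simp add: dist_real_def)
        qed
      qed
    qed simp
  qed
  moreover have "dense_family X (range P) (P n)" for n
    unfolding dense_family_def
  proof (intro allI impI)
    fix h :: "'a \<Rightarrow> real" and H d :: real assume h: "\<forall>x\<in>X. h x \<le> H" and "0 < d"
    obtain a d' where "continuous_on X a" "affine_fun_on X a"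
      "\<And>x. x \<in> X \<Longrightarrow> \<bar>a x\<bar> \<le> d / 8" "0 < d'" "d' \<le> d / 2"
      "\<And>x y. x \<in> closure (near_max X (\<lambda>x. h x + a x) d') \<Longrightarrow>
        y \<in> closure (near_max X (\<lambda>x. h x + a x) d') \<Longrightarrow> \<bar>f x - f y\<bar> \<le> 1 / real (Suc n)"
    proof (rule ex_perturbation_small_osc[OF X f])
      show "h x \<le> H" if "x \<in> X" for x using h that by blast
      show "0 < d" "0 < 1 / real (Suc n)" using \<open>0 < d\<close> by simp_all
    qed blast
    then show "\<exists>a d'. affine_fun_on X a \<and> controlled X (range P) a \<and> (\<forall>x\<in>X. \<bar>a x\<bar> \<le> d / 8) \<and>
        0 < d' \<and> d' \<le> d / 2 \<and> near_max X (\<lambda>x. h x + a x) d' \<in> P n"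
      unfolding P_def
      by (intro exI[of _ a] exI[of _ d'] conjI continuous_on_imp_controlled) auto
  qed
  ultimately show ?thesis
    unfolding tame_def by (intro exI[of _ "range P"]) auto
qed

text \<open>On a set satisfying \<open>P j\<close>, one approximant is uniformly close to
  \<open>u\<close>, and by monotonicity so are all later ones. This local uniformity transfers
  control from the approximants to \<open>u\<close> although the convergence is only
  pointwise.\<close>

lemma tame_incseq_lim:
  fixes X :: "'a::locally_convex_space set"
  assumes "X \<noteq> {}" and g: "\<And>n. tame X (g n)" "\<And>n. affine_fun_on X (g n)"
    and bdd: "\<And>n x. x \<in> X \<Longrightarrow> \<bar>g n x\<bar> \<le> C" "\<And>x. x \<in> X \<Longrightarrow> \<bar>u x\<bar> \<le> C"
    and inc: "\<And>x. x \<in> X \<Longrightarrow> incseq (\<lambda>n. g n x)"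
    and lim: "\<And>x. x \<in> X \<Longrightarrow> (\<lambda>n. g n x) \<longlonglongrightarrow> u x" and u: "affine_fun_on X u"
  shows "tame X u"
proof -
  obtain R where R: "\<And>n. countable (R n)" "\<And>n. controlled X (R n) (g n)"
    "\<And>n P. P \<in> R n \<Longrightarrow> dense_family X (R n) P"
    using g(1) unfolding tame_def by metis
  define P where "P j = {M. \<exists>k. \<forall>x\<in>M. u x - g k x < 1 / real (Suc j)}" for j
  define S where "S = (\<Union>n. R n) \<union> range P"
  have le: "g n x \<le> u x" if "x \<in> X" for n x
    using incseq_le[OF inc lim] that by blast
  have g_ctrl: "controlled X S (g n)" for n
    using R(2) by (rule controlled_mono) (auto simp: S_def)
  have u_ctrl: "controlled X S u"
    unfolding controlled_def
  proof (intro ballI allI impI tendstoI)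
    fix z F and e :: real
    assume z: "z \<in> X" "F \<le> nhds z" "F \<le> principal X" "\<forall>P\<in>S. \<exists>M\<in>P. F \<le> principal M" and "0 < e"
    obtain j where j: "1 / real (Suc j) < e / 3"
      using nat_approx_posE[of "e / 3"] \<open>0 < e\<close> by auto
    have "P j \<in> S" by (simp add: S_def)
    with z(4) obtain M where M: "M \<in> P j" "F \<le> principal M" by blast
    then obtain k where k: "\<And>x. x \<in> M \<Longrightarrow> u x - g k x < 1 / real (Suc j)"
      unfolding P_def by blast
    \<comment> \<open>z need not lie in M, so m must be at least k for closeness on M and also large
      enough for closeness at z.\<close>
    have "eventually (\<lambda>n. dist (g n z) (u z) < e / 3) sequentially"
      using tendstoD[OF lim[OF z(1)], of "e / 3"] \<open>0 < e\<close> by simp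
    then obtain m where m: "k \<le> m" "dist (g m z) (u z) < e / 3"
      using eventually_happens'[OF sequentially_bot eventually_conj[OF eventually_ge_at_top[of k]]]
      by blast
    have "(g m \<longlongrightarrow> g m z) F"
      using z by (intro controlledD[OF g_ctrl]) auto
    then have "eventually (\<lambda>x. dist (g m x) (g m z) < e / 3) F"
      using \<open>0 < e\<close> by (intro tendstoD) auto
    moreover have "eventually (\<lambda>x. x \<in> M) F" "eventually (\<lambda>x. x \<in> X) F"
      using M(2) z(3) by (simp_all add: le_principal)
    ultimately show "eventually (\<lambda>x. dist (u x) (u z) < e) F"
    proof eventually_elim
      case (elim x)
      have "g k x \<le> g m x" using inc[OF elim(3)] m(1) by (rule incseqD)
      then have "\<bar>u x - g m x\<bar> < e / 3"
        using k[OF elim(2)] le[OF elim(3), of m] j by linarith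
      then show ?case using elim(1) m(2) unfolding dist_real_def by linarith
    qed
  qed
  have "dense_family X S (P j)" for j
    unfolding dense_family_def
  proof (intro allI impI)
    fix h :: "'a \<Rightarrow> real" and H d :: real assume h: "\<forall>x\<in>X. h x \<le> H" and "0 < d"
    define \<epsilon> where "\<epsilon> = 1 / real (Suc j)"
    have "0 < \<epsilon>" by (simp add: \<epsilon>_def)
    have "0 \<le> C" using bdd(2) \<open>X \<noteq> {}\<close> by force
    \<comment> \<open>As |u - g k| is at most 2C, this factor keeps the perturbation below d / 8; C
      + 1 avoids division by zero.\<close>
    define t where "t = d / (16 * (C + 1))"
    have t: "0 < t" "t * (2 * C) \<le> d / 8"
      using \<open>0 \<le> C\<close> \<open>0 < d\<close> by (auto simp: t_def divide_simps)
    have t\<epsilon>: "0 < t * \<epsilon> / 4" using t(1) \<open>0 < \<epsilon>\<close> by simp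
    \<comment> \<open>Three errors of size t \<epsilon> / 4 will add up: near maximality of y, the
      approximation error at y, and the tolerance d'. Their sum stays below t \<epsilon>.\<close>
    have "near_max X h (t * \<epsilon> / 4) \<noteq> {}"
      using h by (intro near_max_nonempty[OF \<open>X \<noteq> {}\<close> _ t\<epsilon>]) auto
    then obtain y where y: "y \<in> X" "\<And>x. x \<in> X \<Longrightarrow> h x \<le> h y + t * \<epsilon> / 4"
      by (auto simp: near_max_def)
    have "eventually (\<lambda>n. dist (g n y) (u y) < \<epsilon> / 4) sequentially"
      using tendstoD[OF lim[OF y(1)], of "\<epsilon> / 4"] \<open>0 < \<epsilon>\<close> by simp
    then obtain k where "dist (g k y) (u y) < \<epsilon> / 4"
      using eventually_happens'[OF sequentially_bot] by blast
    then have "u y - g k y \<le> \<epsilon> / 4" unfolding dist_real_def by linarith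
    then have k: "t * (u y - g k y) \<le> t * \<epsilon> / 4"
      using t(1) mult_left_mono[of "u y - g k y" "\<epsilon> / 4" t] by simp
    \<comment> \<open>Subtracting a multiple of the error \<open>u - g k\<close>, which is nearly \<open>0\<close> at the almost maximal
      point \<open>y\<close>, makes the error small at all almost maximal points.\<close>
    define a where "a x = - t * (u x + (- 1) * g k x)" for x
    define d' where "d' = min (d / 2) (t * \<epsilon> / 4)"
    show "\<exists>a d'. affine_fun_on X a \<and> controlled X S a \<and> (\<forall>x\<in>X. \<bar>a x\<bar> \<le> d / 8) \<and>
        0 < d' \<and> d' \<le> d / 2 \<and> near_max X (\<lambda>x. h x + a x) d' \<in> P j"
    proof (intro exI[of _ a] exI[of _ d'] conjI ballI)
      show "affine_fun_on X a"
        unfolding a_def by (intro affine_fun_on_cmult affine_fun_on_add u g(2))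
      show "controlled X S a"
        unfolding a_def by (intro controlled_cmult controlled_add u_ctrl g_ctrl)
      show "\<bar>a x\<bar> \<le> d / 8" if "x \<in> X" for x
      proof -
        have "\<bar>a x\<bar> = t * \<bar>u x - g k x\<bar>" using t(1) by (simp add: a_def abs_mult)
        also have "\<dots> \<le> t * (2 * C)"
          using bdd(1)[OF that, of k] bdd(2)[OF that] t(1) by (intro mult_left_mono) auto
        finally show ?thesis using t(2) by linarith
      qed
      show "0 < d'" "d' \<le> d / 2" using \<open>0 < d\<close> t\<epsilon> by (auto simp: d'_def)
      have "u x - g k x < \<epsilon>" if "x \<in> near_max X (\<lambda>x. h x + a x) d'" for x
      proof -
        have x: "x \<in> X" "h y + a y \<le> h x + a x + d'"
          using that y(1) by (auto simp: near_max_def)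
        moreover have "a y = - (t * (u y - g k y))" "a x = - (t * (u x - g k x))"
          by (simp_all add: a_def)
        moreover have "d' \<le> t * \<epsilon> / 4" by (simp add: d'_def)
        ultimately have "t * (u x - g k x) < t * \<epsilon>"
          using y(2)[OF x(1)] k t\<epsilon> by linarith
        then show ?thesis using t(1) by simp
      qed
      then show "near_max X (\<lambda>x. h x + a x) d' \<in> P j"
        unfolding P_def \<epsilon>_def by blast
    qed
  qed
  moreover have "dense_family X S Q" if "Q \<in> R n" for Q n
    using R(3)[OF that] by (rule dense_family_mono) (auto simp: S_def)
  ultimately have "\<forall>Q\<in>S. dense_family X S Q" by (auto simp: S_def)
  moreover have "countable S" unfolding S_def using R(1) by auto
  moreover have "S \<noteq> {}" by (auto simp: S_def)
  ultimately show ?thesis using u_ctrl unfolding tame_def by blast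
qed

text \<open>Affineness belongs to the induction because limit steps perturb by multiples of u - g k.
  Decreasing limits reduce to increasing ones by a change of sign.\<close>

lemma monotone_closure_tame:
  fixes X :: "'a::locally_convex_space set"
  assumes X: "compact X" "convex X" "X \<noteq> {}" and "u \<in> monotone_closure X (A_f X)"
  shows "affine_fun_on X u \<and> (\<exists>B. \<forall>x\<in>X. \<bar>u x\<bar> \<le> B) \<and> tame X u"
  using assms(4)
proof induction
  case (base f)
  then have f: "affine_fun_on X f" "fragmented_on X f" by (simp_all add: A_f_def)
  then show ?case using A_f_tame[OF X f] A_f_bounded[OF X(1,2) f] by metis
next
  case (limit g u)
  then obtain C where C: "\<And>n x. x \<in> X \<Longrightarrow> \<bar>g n x\<bar> \<le> C" by blast
  have lim: "\<And>x. x \<in> X \<Longrightarrow> (\<lambda>n. g n x) \<longlonglongrightarrow> u x" using limit by blast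
  have g: "\<And>n. tame X (g n)" "\<And>n. affine_fun_on X (g n)" using limit by blast+
  have u: "affine_fun_on X u" using affine_fun_on_lim[OF X(2) g(2) lim] .
  have uC: "\<bar>u x\<bar> \<le> C" if "x \<in> X" for x
    using C[OF that] by (intro LIMSEQ_le_const2[OF tendsto_rabs[OF lim[OF that]]]) auto
  have "tame X u"
  proof (cases "\<forall>x\<in>X. incseq (\<lambda>n. g n x)")
    case True
    then show ?thesis using tame_incseq_lim[OF X(3) g C uC _ lim u] by blast
  next
    case False
    then have dec: "\<And>x. x \<in> X \<Longrightarrow> decseq (\<lambda>n. g n x)" using limit by blast
    have "tame X (\<lambda>x. - u x)"
    proof (rule tame_incseq_lim[OF X(3)])
      show "tame X (\<lambda>x. - g n x)" for n using g(1) by (rule tame_uminus)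
      show "affine_fun_on X (\<lambda>x. - g n x)" for n using g(2) by (rule affine_fun_on_uminus)
      show "\<bar>- g n x\<bar> \<le> C" if "x \<in> X" for n x using C[OF that] by simp
      show "\<bar>- u x\<bar> \<le> C" if "x \<in> X" for x using uC[OF that] by simp
      show "incseq (\<lambda>n. - g n x)" if "x \<in> X" for x
        using dec[OF that] by (simp add: decseq_eq_incseq)
      show "(\<lambda>n. - g n x) \<longlonglongrightarrow> - u x" if "x \<in> X" for x using lim[OF that] by (rule tendsto_minus)
      show "affine_fun_on X (\<lambda>x. - u x)" using u by (rule affine_fun_on_uminus)
    qed
    then show ?thesis using tame_uminus by fastforce
  qed
  then show ?case using u uC by blast
qed

lemma monotone_closure_uminus:
  assumes "\<And>f. f \<in> F \<Longrightarrow> (\<lambda>x. - f x) \<in> F" and "u \<in> monotone_closure X F"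
  shows "(\<lambda>x. - u x) \<in> monotone_closure X F"
  using assms(2)
proof induction
  case (base f)
  then show ?case using assms(1) monotone_closure.base by blast
next
  case (limit g u)
  show ?case
  proof (rule monotone_closure.limit)
    show "(\<lambda>x. - g n x) \<in> monotone_closure X F" for n using limit by blast
    have "(\<forall>x\<in>X. incseq (\<lambda>n. g n x)) \<or> (\<forall>x\<in>X. decseq (\<lambda>n. g n x))"
      using limit by blast
    then show "(\<forall>x\<in>X. incseq (\<lambda>n. - g n x)) \<or> (\<forall>x\<in>X. decseq (\<lambda>n. - g n x))"
      by (auto simp: decseq_eq_incseq)
    show "\<exists>C. \<forall>n. \<forall>x\<in>X. \<bar>- g n x\<bar> \<le> C" using limit by simp
    show "\<forall>x\<in>X. (\<lambda>n. - g n x) \<longlonglongrightarrow> - u x" using limit by (auto intro: tendsto_minus)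
  qed
qed

text \<open>The perturbed limit \<open>H\<close> differs from \<open>u\<close> by at most d / 4. It
  is enough that its maximisers form a nonempty compact face; \<open>H_max\<close> yields both
  nonemptiness and closedness.\<close>

lemma tame_extreme_point:
  fixes X :: "'a::locally_convex_space set"
  assumes X: "compact X" "convex X" "X \<noteq> {}" and u: "affine_fun_on X u" "tame X u"
    and bdd: "\<forall>x\<in>X. u x \<le> B" and "0 < d"
  shows "\<exists>e. e extreme_point_of X \<and> (\<forall>x\<in>X. u x \<le> u e + d)"
proof -
  obtain R where R: "countable R" "R \<noteq> {}" "controlled X R u" "\<And>P. P \<in> R \<Longrightarrow> dense_family X R P"
    using u(2) unfolding tame_def by blast
  define ok where "ok n s \<longleftrightarrow> affine_fun_on X (fst s) \<and> controlled X R (fst s) \<and>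
    (\<exists>H. \<forall>x\<in>X. fst s x \<le> H) \<and> 0 < snd s \<and> (n = 0 \<longrightarrow> s = (u, d))"
    for n :: nat and s :: "('a \<Rightarrow> real) \<times> real"
  \<comment> \<open>Condition number n is met in passing from stage n to stage n + 1; the
    enumeration may repeat members of \<open>R\<close>.\<close>
  define next_ok where "next_ok n s s' \<longleftrightarrow> (\<forall>x\<in>X. \<bar>fst s' x - fst s x\<bar> \<le> snd s / 8) \<and>
    snd s' \<le> snd s / 2 \<and> near_max X (fst s') (snd s') \<in> from_nat_into R n"
    for n and s s' :: "('a \<Rightarrow> real) \<times> real"
  have "\<exists>s. \<forall>n. ok n (s n) \<and> next_ok n (s n) (s (Suc n))"
  proof (rule dependent_nat_choice)
    show "\<exists>s. ok 0 s"
      using u(1) R(3) bdd \<open>0 < d\<close> by (intro exI[of _ "(u, d)"]) (auto simp: ok_def)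
  next
    fix s n assume s: "ok n s"
    then obtain H where H: "\<forall>x\<in>X. fst s x \<le> H" unfolding ok_def by blast
    have "dense_family X R (from_nat_into R n)"
      by (rule R(4)[OF from_nat_into[OF R(2)]])
    from dense_familyD[OF this H, of "snd s"] s obtain a d'
      where a: "affine_fun_on X a" "controlled X R a" "\<And>x. x \<in> X \<Longrightarrow> \<bar>a x\<bar> \<le> snd s / 8"
      "0 < d'" "d' \<le> snd s / 2" "near_max X (\<lambda>x. fst s x + a x) d' \<in> from_nat_into R n"
      by (auto simp: ok_def)
    have "fst s x + a x \<le> H + snd s / 8" if "x \<in> X" for x
      using bspec[OF H that] a(3)[OF that] by linarith
    then show "\<exists>s'. ok (Suc n) s' \<and> next_ok n s s'"
      using s a unfolding ok_def next_ok_def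
      by (intro exI[of _ "(\<lambda>x. fst s x + a x, d')"]) (auto intro: affine_fun_on_add controlled_add)
  qed
  then obtain s where s: "\<And>n. ok n (s n)" "\<And>n. next_ok n (s n) (s (Suc n))" by blast
  define h where "h n = fst (s n)" for n
  define \<delta> where "\<delta> n = snd (s n)" for n
  have h0: "h 0 = u" "\<delta> 0 = d" using s(1)[of 0] by (auto simp: ok_def h_def \<delta>_def)
  have h_aff: "affine_fun_on X (h n)" and h_ctrl: "controlled X R (h n)"
    and h_bdd: "\<exists>H. \<forall>x\<in>X. h n x \<le> H" and \<delta>_pos: "0 < \<delta> n" for n
    using s(1)[of n] by (auto simp: ok_def h_def \<delta>_def)
  have h_step: "x \<in> X \<Longrightarrow> \<bar>h (Suc n) x - h n x\<bar> \<le> \<delta> n / 8" and \<delta>_step: "\<delta> (Suc n) \<le> \<delta> n / 2"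
    and h_mem: "near_max X (h (Suc n)) (\<delta> (Suc n)) \<in> from_nat_into R n" for n x
    using s(2)[of n] by (auto simp: next_ok_def h_def \<delta>_def)
  \<comment> \<open>A telescoping bound: halving the tolerance gives \<delta> n / 8 \<le> \<delta> n
    / 4 - \<delta> (n + 1) / 4.\<close>
  have tail: "\<bar>h (n + k) x - h n x\<bar> \<le> \<delta> n / 4 - \<delta> (n + k) / 4" if "x \<in> X" for n k x
  proof (induction k)
    case (Suc k)
    then show ?case
      using h_step[OF that, of "n + k"] \<delta>_step[of "n + k"] unfolding add_Suc_right by linarith
  qed simp
  have \<delta>_small: "\<exists>n. \<delta> n < e" if "0 < e" for e
  proof -
    have "\<delta> n \<le> d * (1/2) ^ n" for n
    proof (induction n)
      case (Suc n)
      then show ?case using \<delta>_step[of n] by simp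
    qed (simp add: h0)
    moreover have "0 < e / d" using that \<open>0 < d\<close> by simp
    then obtain n where "(1/2) ^ n < e / d"
      using real_arch_pow_inv[of "e / d" "1/2"] by auto
    then have "d * (1/2) ^ n < e"
      using \<open>0 < d\<close> by (simp add: pos_less_divide_eq mult.commute)
    ultimately show ?thesis by (meson le_less_trans)
  qed
  have "convergent (\<lambda>n. h n x)" if "x \<in> X" for x
  proof -
    have "Cauchy (\<lambda>n. h n x)"
    proof (rule metric_CauchyI)
      fix e :: real assume "0 < e"
      then obtain N where N: "\<delta> N < e" using \<delta>_small by blast
      have near: "\<bar>h m x - h N x\<bar> < e / 4" if "N \<le> m" for m
        using tail[OF \<open>x \<in> X\<close>, of N "m - N"] N \<delta>_pos[of m]
        unfolding le_add_diff_inverse[OF that] by linarith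
      have "dist (h m x) (h n x) < e" if "N \<le> m" "N \<le> n" for m n
        using near[OF that(1)] near[OF that(2)] \<open>0 < e\<close> unfolding dist_real_def by linarith
      then show "\<exists>M. \<forall>m\<ge>M. \<forall>n\<ge>M. dist (h m x) (h n x) < e" by blast
    qed
    then show ?thesis by (rule Cauchy_convergent)
  qed
  then obtain H where H: "\<And>x. x \<in> X \<Longrightarrow> (\<lambda>n. h n x) \<longlonglongrightarrow> H x"
    unfolding convergent_def by metis
  have H_aff: "affine_fun_on X H" by (rule affine_fun_on_lim[OF X(2) h_aff H])
  have hH: "\<bar>H x - h n x\<bar> \<le> \<delta> n / 4" if "x \<in> X" for n x
  proof -
    have "(\<lambda>k. \<bar>h (k + n) x - h n x\<bar>) \<longlonglongrightarrow> \<bar>H x - h n x\<bar>"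
      using H[OF that] by (intro tendsto_intros LIMSEQ_ignore_initial_segment)
    then show ?thesis
    proof (rule LIMSEQ_le_const2, intro exI allI impI)
      fix k show "\<bar>h (k + n) x - h n x\<bar> \<le> \<delta> n / 4"
        using tail[OF that, of n k] \<delta>_pos[of "n + k"] by (simp add: add.commute)
    qed
  qed
  define N where "N n = near_max X (h n) (\<delta> n)" for n
  have N_dec: "N m \<subseteq> N n" if "n \<le> m" for n m
  proof (rule lift_Suc_antimono_le[OF _ that])
    fix n show "N (Suc n) \<subseteq> N n"
      unfolding N_def using h_step \<delta>_step[of n]  \<delta>_pos[of n]
      by (intro near_max_perturb[where r = "\<delta> n / 8"]) auto
  qed
  \<comment> \<open>Each \<open>h n\<close> converges along F by control, and \<open>H\<close> is
    their uniform limit. Since F lives on every \<open>N n\<close>, the values of \<open>H\<close>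
    along F are eventually maximal up to 2 \<delta> n, and the limit \<open>H z\<close> inherits
    this.\<close>
  have H_max: "H y \<le> H z"
    if F: "F \<noteq> bot" "F \<le> nhds z" "F \<le> principal X" "\<And>n. F \<le> principal (N n)"
      and "z \<in> X" "y \<in> X" for F z y
  proof -
    have "(H \<longlongrightarrow> H z) F"
    proof (rule tendstoI)
      fix e :: real assume "0 < e"
      then obtain n where n: "\<delta> n < e" using \<delta>_small by blast
      have "(h n \<longlongrightarrow> h n z) F"
      proof (rule controlledD[OF h_ctrl \<open>z \<in> X\<close> F(2,3)], intro ballI)
        fix P assume "P \<in> R"
        then obtain k where "P = from_nat_into R k"
          using R(1) by (metis from_nat_into_surj)
        then have "N (Suc k) \<in> P" using h_mem by (simp add: N_def)
        then show "\<exists>M\<in>P. F \<le> principal M" using F(4) by blast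
      qed
      then have "eventually (\<lambda>x. dist (h n x) (h n z) < e / 4) F"
        using \<open>0 < e\<close> by (intro tendstoD) auto
      moreover have "eventually (\<lambda>x. x \<in> X) F" using F(3) by (simp add: le_principal)
      ultimately show "eventually (\<lambda>x. dist (H x) (H z) < e) F"
      proof eventually_elim
        case (elim x)
        then show ?case
          using hH[OF elim(2), of n] hH[OF \<open>z \<in> X\<close>, of n] n unfolding dist_real_def by linarith
      qed
    qed
    moreover have "eventually (\<lambda>x. H y - 2 * \<delta> n \<le> H x) F" for n
    proof -
      have "eventually (\<lambda>x. x \<in> N n) F" using F(4) by (simp add: le_principal)
      then show ?thesis
      proof eventually_elim
        case (elim x)
        then have "x \<in> X" "h n y \<le> h n x + \<delta> n" using \<open>y \<in> X\<close> by (auto simp: N_def near_max_def)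
        then show ?case using hH[OF \<open>x \<in> X\<close>, of n] hH[OF \<open>y \<in> X\<close>, of n] \<delta>_pos[of n] by linarith
      qed
    qed
    ultimately have le: "H y - 2 * \<delta> n \<le> H z" for n
      using tendsto_lowerbound F(1) by blast
    show ?thesis
    proof (rule field_le_epsilon)
      fix e :: real assume "0 < e"
      then obtain n where "\<delta> n < e / 2" using \<delta>_small[of "e / 2"] by auto
      then show "H y \<le> H z + e" using le[of n] by linarith
    qed
  qed
  define A where "A = {x \<in> X. \<forall>y\<in>X. H y \<le> H x}"
  have "A \<noteq> {}"
  proof -
    have "N n \<noteq> {}" for n
      unfolding N_def using h_bdd[of n] near_max_nonempty[OF X(3) _ \<delta>_pos] by blast
    then have "\<forall>n. \<exists>y. y \<in> N n" by blast
    then obtain y where y: "\<And>n. y n \<in> N n" by metis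
    \<comment> \<open>X need not be metrizable, so y may lack convergent subsequences; a cluster
      point z with the filter \<open>inf (nhds z) F0\<close> replaces them.\<close>
    define F0 where "F0 = filtermap y sequentially"
    have F0: "F0 \<le> principal (N n)" for n
      unfolding F0_def le_principal eventually_filtermap
      using eventually_ge_at_top[of n] by eventually_elim (use y N_dec in blast)
    have NX: "N n \<subseteq> X" for n unfolding N_def by (rule near_max_subset)
    have F0X: "F0 \<le> principal X"
      using F0[of 0] NX[of 0] by (meson order_trans principal_le_iff)
    moreover have "F0 \<noteq> bot" unfolding F0_def by (simp add: filtermap_bot_iff)
    ultimately obtain z where z: "z \<in> X" "inf (nhds z) F0 \<noteq> bot"
      using X(1) unfolding compact_filter by (metis le_principal)
    have "H y \<le> H z" if "y \<in> X" for y
      using F0 F0X by (intro H_max[OF z(2) _ _ _ z(1) that]) (auto intro: le_infI2)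
    then show ?thesis using z(1) by (auto simp: A_def)
  qed
  \<comment> \<open>Replacing \<open>H\<close> by \<open>h n\<close> costs \<delta> n / 4 at each of
    two points, within the tolerance \<delta> n. Hence the neighbourhood filter traced on
    \<open>A\<close> also qualifies for \<open>H_max\<close>.\<close>
  have A_N: "A \<subseteq> N n" for n
  proof
    fix x assume x: "x \<in> A"
    then have "x \<in> X" by (simp add: A_def)
    have "h n y \<le> h n x + \<delta> n" if "y \<in> X" for y
    proof -
      have "H y \<le> H x" using x that by (simp add: A_def)
      then show ?thesis
        using hH[OF \<open>x \<in> X\<close>, of n] hH[OF that, of n] \<delta>_pos[of n] by linarith
    qed
    then show "x \<in> N n" using \<open>x \<in> X\<close> by (simp add: N_def near_max_def)
  qed
  have "A \<subseteq> X" by (auto simp: A_def)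
  have "closure A \<subseteq> A"
  proof
    fix z assume z: "z \<in> closure A"
    have "z \<in> X"
      using z closure_minimal[OF \<open>A \<subseteq> X\<close> compact_imp_closed[OF X(1)]] by blast
    have "H y \<le> H z" if "y \<in> X" for y
    proof (rule H_max[OF inf_nhds_principal_neq_bot[OF z] _ _ _ \<open>z \<in> X\<close> that])
      show "inf (nhds z) (principal A) \<le> principal X" "inf (nhds z) (principal A) \<le> principal (N n)" for n
        using \<open>A \<subseteq> X\<close> A_N by (auto intro: le_infI2)
    qed simp
    then show "z \<in> A" using \<open>z \<in> X\<close> by (simp add: A_def)
  qed
  then have "compact A"
    using compact_Int_closed[OF X(1), of A] \<open>A \<subseteq> X\<close> by (simp add: closure_subset_eq Int_absorb1)
  obtain m where m: "m \<in> A" using \<open>A \<noteq> {}\<close> by blast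
  have A_eq: "A = {x \<in> X. H m \<le> H x}"
    using m by (auto simp: A_def intro: order_trans)
  have "convex A" unfolding A_eq by (rule convex_affine_ge[OF H_aff X(2)])
  have "A face_of X"
    unfolding face_of_def
  proof (intro conjI ballI impI)
    fix a b x assume ab: "a \<in> X" "b \<in> X" "x \<in> A" "x \<in> open_segment a b"
    then obtain t where t: "0 < t" "t < 1" "x = (1 - t) *\<^sub>R a + t *\<^sub>R b"
      by (auto simp: in_segment)
    have "H x = (1 - t) * H a + t * H b"
      unfolding t(3) using t ab by (intro affine_fun_onD[OF H_aff]) auto
    then have "(1 - t) * (H x - H a) + t * (H x - H b) = 0" by (simp add: algebra_simps)
    moreover have "0 \<le> (1 - t) * (H x - H a)" "0 \<le> t * (H x - H b)"
      using ab t by (auto simp: A_def)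
    ultimately have "(1 - t) * (H x - H a) = 0" "t * (H x - H b) = 0" by linarith+
    then have "H a = H x" "H b = H x" using t by auto
    then show "a \<in> A" "b \<in> A" using ab by (auto simp: A_def)
  qed fact+
  obtain e where "e extreme_point_of A"
    using ex_extreme_point_of[OF \<open>compact A\<close> \<open>convex A\<close> \<open>A \<noteq> {}\<close>] .
  then have e: "e extreme_point_of X" "e \<in> A"
    using extreme_point_of_face[OF \<open>A face_of X\<close>] by blast+
  show ?thesis
  proof (intro exI conjI ballI, rule e(1))
    fix x assume "x \<in> X"
    moreover have "e \<in> X" "H x \<le> H e" using e(2) \<open>x \<in> X\<close> by (simp_all add: A_def)
    ultimately show "u x \<le> u e + d"
      using hH[of x 0] hH[of e 0] \<open>0 < d\<close> unfolding h0 by linarith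
  qed
qed

theorem theorem7p4:
  fixes X :: "'a::locally_convex_space set"
  assumes "compact X" and "convex X"
  shows "determined_by_extreme_points X (monotone_closure X (A_f X))"
  unfolding determined_by_extreme_points_def
proof (intro ballI conjI)
  fix u x assume u: "u \<in> monotone_closure X (A_f X)" and x: "x \<in> X"
  then have "X \<noteq> {}" by blast
  have approx: "\<exists>e. e extreme_point_of X \<and> v x \<le> v e + d"
    if v_mem: "v \<in> monotone_closure X (A_f X)" and d: "0 < d" for v d
  proof -
    obtain B where v: "affine_fun_on X v" "tame X v" "\<forall>x\<in>X. \<bar>v x\<bar> \<le> B"
      using monotone_closure_tame[OF assms \<open>X \<noteq> {}\<close> v_mem] by blast
    then have "\<forall>x\<in>X. v x \<le> B" using abs_le_D1 by blast
    from tame_extreme_point[OF assms \<open>X \<noteq> {}\<close> v(1,2) this d] show ?thesis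
      using x by blast
  qed
  show "ereal (u x) \<le> (SUP e\<in>{e. e extreme_point_of X}. ereal (u e))"
  proof (rule ereal_le_epsilon2)
    fix d :: real assume "0 < d"
    from approx[OF u this] obtain e where e: "e extreme_point_of X" "u x \<le> u e + d" by blast
    have "ereal (u x) \<le> ereal (u e) + ereal d" using e(2) by simp
    also have "\<dots> \<le> (SUP e\<in>{e. e extreme_point_of X}. ereal (u e)) + ereal d"
      using e(1) by (intro add_right_mono SUP_upper) simp
    finally show "ereal (u x) \<le> (SUP e\<in>{e. e extreme_point_of X}. ereal (u e)) + ereal d" .
  qed
  have "(\<lambda>x. - f x) \<in> A_f X" if "f \<in> A_f X" for f
    using that affine_fun_on_uminus fragmented_on_uminus by (auto simp: A_f_def)
  then have u': "(\<lambda>x. - u x) \<in> monotone_closure X (A_f X)"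
    using u by (rule monotone_closure_uminus)
  show "(INF e\<in>{e. e extreme_point_of X}. ereal (u e)) \<le> ereal (u x)"
  proof (rule ereal_le_epsilon2)
    fix d :: real assume "0 < d"
    from approx[OF u' this] obtain e where e: "e extreme_point_of X" "u e \<le> u x + d" by auto
    have "(INF e\<in>{e. e extreme_point_of X}. ereal (u e)) \<le> ereal (u e)"
      using e(1) by (intro INF_lower) simp
    also have "\<dots> \<le> ereal (u x) + ereal d" using e(2) by simp
    finally show "(INF e\<in>{e. e extreme_point_of X}. ereal (u e)) \<le> ereal (u x) + ereal d" .
  qed
qed

end
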